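(* Let $k$ be a field, $H$ a cosemisimple bialgebra over $k$ with cointegral $\lambda\in H^\ast$, and $M$ a left $H$-comodule. Define linear maps $T:M\to M$ and $P:H\to H$ by $T(m)=\lambda(m_{(-1)})m_{(0)}$ and $P(h)=\lambda(h_1)h_2$ for $m\in M$, $h\in H$. Then $(M,P,T)$ is a Rota-Baxter paired $H$-comodule of weight $-1$. In particular, $(H,P)$ is a Rota-Baxter coalgebra of weight $-1$.
   Context: All spaces, maps and tensor products are over $k$. Sweedler notation: $\Delta(h)=h_1\otimes h_2$; left coaction $\rho(m)=m_{(-1)}\otimes m_{(0)}\in H\otimes M$. $H^\ast$ is the linear dual with convolution product, and $\varepsilon_{H^\ast}(f)=f(1_H)$. An element $\lambda\in H^\ast$ is a left cointegral if $f\lambda=\varepsilon_{H^\ast}(f)\lambda$ for all $f\in H^\ast$. In the paper's terminology, $H$ is a cosemisimple bialgebra (with cointegral $\lambda$) if $\lambda$ is a left cointegral with $\varepsilon_{H^\ast}(\lambda)=1$. For linear maps $P:H\to H$, $T:M\to M$, the triple $(M,P,T)$ is a Rota-Baxter paired (left) $H$-comodule of weight $\mu\in k$ if $(P\otimes T)\rho=(P\otimes \mathrm{id})\rho T+(\mathrm{id}\otimes T)\rho T+\mu\rho T$. A coalgebra $C$ with a linear map $P:C\to C$ is a Rota-Baxter coalgebra of weight $\mu$ if $(P\otimes P)\Delta=(P\otimes \mathrm{id})\Delta P+(\mathrm{id}\otimes P)\Delta P+\mu\Delta P$. *)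

theory Defs
  imports "Jordan_Normal_Form.Missing_VectorSpace" "HOL-Algebra.Free_Abelian_Groups"
begin

section \<open>Tensor products\<close>

text \<open>
  The tensor product of two \<open>K\<close>-modules is the free abelian group on pairs modulo the subgroup
  generated by the relators of a biadditive, \<open>K\<close>-balanced map; the scalars act through the
  left factor. A tensor is thus a coset in the free abelian group.
\<close>

definition tensor_relators ::
  "('k, 'x) ring_scheme \<Rightarrow> ('k, 'a, 'y) module_scheme \<Rightarrow> ('k, 'b, 'z) module_scheme
    \<Rightarrow> ('a \<times> 'b \<Rightarrow>\<^sub>0 int) set" where
  "tensor_relators K M N =
     {frag_of (x \<oplus>\<^bsub>M\<^esub> x', y) - frag_of (x, y) - frag_of (x', y) | x x' y.
        x \<in> carrier M \<and> x' \<in> carrier M \<and> y \<in> carrier N} \<union>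
     {frag_of (x, y \<oplus>\<^bsub>N\<^esub> y') - frag_of (x, y) - frag_of (x, y') | x y y'.
        x \<in> carrier M \<and> y \<in> carrier N \<and> y' \<in> carrier N} \<union>
     {frag_of (a \<odot>\<^bsub>M\<^esub> x, y) - frag_of (x, a \<odot>\<^bsub>N\<^esub> y) | a x y.
        a \<in> carrier K \<and> x \<in> carrier M \<and> y \<in> carrier N}"

definition tensor_kernel ::
  "('k, 'x) ring_scheme \<Rightarrow> ('k, 'a, 'y) module_scheme \<Rightarrow> ('k, 'b, 'z) module_scheme
    \<Rightarrow> ('a \<times> 'b \<Rightarrow>\<^sub>0 int) set" where
  "tensor_kernel K M N =
     generate (free_Abelian_group (carrier M \<times> carrier N)) (tensor_relators K M N)"

definition tensor_group ::
  "('k, 'x) ring_scheme \<Rightarrow> ('k, 'a, 'y) module_scheme \<Rightarrow> ('k, 'b, 'z) module_scheme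
    \<Rightarrow> ('a \<times> 'b \<Rightarrow>\<^sub>0 int) set monoid" where
  "tensor_group K M N =
     free_Abelian_group (carrier M \<times> carrier N) Mod tensor_kernel K M N"

definition pure_tensor ::
  "('k, 'x) ring_scheme \<Rightarrow> ('k, 'a, 'y) module_scheme \<Rightarrow> ('k, 'b, 'z) module_scheme
    \<Rightarrow> 'a \<Rightarrow> 'b \<Rightarrow> ('a \<times> 'b \<Rightarrow>\<^sub>0 int) set" where
  "pure_tensor K M N x y =
     tensor_kernel K M N #>\<^bsub>free_Abelian_group (carrier M \<times> carrier N)\<^esub> frag_of (x, y)"

text \<open>
  The homomorphism into the commutative group \<open>G\<close> (written multiplicatively) induced by \<open>f\<close>, to be
  used only for biadditive and \<open>K\<close>-balanced \<open>f\<close>: then all representatives of the tensor \<open>X\<close> give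
  the same value, i.e.\ the image below is a singleton. In Sweedler notation,
  \<open>tensor_lift G f X\<close> is \<open>f(X\<^sub>1, X\<^sub>2)\<close> for \<open>X = X\<^sub>1 \<otimes> X\<^sub>2\<close>.
\<close>

definition tensor_lift ::
  "('c, 'x) monoid_scheme \<Rightarrow> ('a \<Rightarrow> 'b \<Rightarrow> 'c) \<Rightarrow> ('a \<times> 'b \<Rightarrow>\<^sub>0 int) set \<Rightarrow> 'c" where
  "tensor_lift G f X =
     the_elem ((\<lambda>c. finprod G (\<lambda>p. f (fst p) (snd p) [^]\<^bsub>G\<^esub> Poly_Mapping.lookup c p)
                       (Poly_Mapping.keys c)) ` X)"

text \<open>
  The fields \<open>mult\<close> and \<open>one\<close>, the usual multiplication on a tensor product of algebras,
  are meaningful only if \<open>M\<close> and \<open>N\<close> are \<open>K\<close>-algebras.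
\<close>

definition tensor ::
  "('k, 'x) ring_scheme \<Rightarrow> ('k, 'a, 'y) module_scheme \<Rightarrow> ('k, 'b, 'z) module_scheme
    \<Rightarrow> ('k, ('a \<times> 'b \<Rightarrow>\<^sub>0 int) set) module" where
  "tensor K M N =
     \<lparr> carrier = carrier (tensor_group K M N),
       monoid.mult = (\<lambda>X Y. tensor_lift (tensor_group K M N)
                 (\<lambda>x y. tensor_lift (tensor_group K M N)
                    (\<lambda>x' y'. pure_tensor K M N (x \<otimes>\<^bsub>M\<^esub> x') (y \<otimes>\<^bsub>N\<^esub> y')) Y) X),
       monoid.one = pure_tensor K M N \<one>\<^bsub>M\<^esub> \<one>\<^bsub>N\<^esub>,
       ring.zero = \<one>\<^bsub>tensor_group K M N\<^esub>,
       ring.add = (\<otimes>\<^bsub>tensor_group K M N\<^esub>),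
       module.smult = (\<lambda>a. tensor_lift (tensor_group K M N) (\<lambda>x y. pure_tensor K M N (a \<odot>\<^bsub>M\<^esub> x) y)) \<rparr>"

definition tensor_map ::
  "('k, 'x) ring_scheme \<Rightarrow> ('k, 'c, 'y) module_scheme \<Rightarrow> ('k, 'd, 'z) module_scheme
    \<Rightarrow> ('a \<Rightarrow> 'c) \<Rightarrow> ('b \<Rightarrow> 'd) \<Rightarrow> ('a \<times> 'b \<Rightarrow>\<^sub>0 int) set \<Rightarrow> ('c \<times> 'd \<Rightarrow>\<^sub>0 int) set" where
  "tensor_map K M' N' f g =
     tensor_lift (add_monoid (tensor K M' N')) (\<lambda>x y. pure_tensor K M' N' (f x) (g y))"

text \<open>The canonical isomorphism from \<open>(A \<otimes> B) \<otimes> C\<close> to \<open>A \<otimes> (B \<otimes> C)\<close>.\<close>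

definition tensor_assoc ::
  "('k, 'x) ring_scheme \<Rightarrow> ('k, 'a, 'u) module_scheme \<Rightarrow> ('k, 'b, 'v) module_scheme
    \<Rightarrow> ('k, 'c, 'w) module_scheme
    \<Rightarrow> (('a \<times> 'b \<Rightarrow>\<^sub>0 int) set \<times> 'c \<Rightarrow>\<^sub>0 int) set \<Rightarrow> ('a \<times> ('b \<times> 'c \<Rightarrow>\<^sub>0 int) set \<Rightarrow>\<^sub>0 int) set" where
  "tensor_assoc K A B C =
     tensor_lift (add_monoid (tensor K A (tensor K B C)))
       (\<lambda>X z. tensor_lift (add_monoid (tensor K A (tensor K B C)))
          (\<lambda>x y. pure_tensor K A (tensor K B C) x (pure_tensor K B C y z)) X)"


section \<open>Coalgebras, bialgebras and comodules\<close>

definition ground :: "('k, 'x) ring_scheme \<Rightarrow> ('k, 'k) module" where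
  "ground K = \<lparr> carrier = carrier K, monoid.mult = (\<otimes>\<^bsub>K\<^esub>), monoid.one = \<one>\<^bsub>K\<^esub>,
                ring.zero = \<zero>\<^bsub>K\<^esub>, ring.add = (\<oplus>\<^bsub>K\<^esub>), module.smult = (\<otimes>\<^bsub>K\<^esub>) \<rparr>"

text \<open>
  Functionals are functions on the whole type whose values off the carrier are irrelevant;
  equality in the dual is equality on the carrier.
\<close>

definition dual :: "('k, 'x) ring_scheme \<Rightarrow> ('k, 'a, 'y) module_scheme \<Rightarrow> ('a \<Rightarrow> 'k) set" where
  "dual K V = module_hom K V (ground K)"

text \<open>The identifications of \<open>K \<otimes> C\<close> and \<open>C \<otimes> K\<close> with \<open>C\<close> are built into the counit laws.\<close>

locale coalgebra = vectorspace K C for K (structure) and C (structure) +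
  fixes \<Delta> :: "'c \<Rightarrow> ('c \<times> 'c \<Rightarrow>\<^sub>0 int) set" and \<epsilon> :: "'c \<Rightarrow> 'a"
  assumes comult_linear: "\<Delta> \<in> module_hom K C (tensor K C C)"
    and counit_linear: "\<epsilon> \<in> dual K C"
    and coassoc: "c \<in> carrier C \<Longrightarrow>
      tensor_assoc K C C C (tensor_map K (tensor K C C) C \<Delta> id (\<Delta> c)) =
      tensor_map K C (tensor K C C) id \<Delta> (\<Delta> c)"
    and counit_left: "c \<in> carrier C \<Longrightarrow> tensor_lift (add_monoid C) (\<lambda>x y. \<epsilon> x \<odot>\<^bsub>C\<^esub> y) (\<Delta> c) = c"
    and counit_right: "c \<in> carrier C \<Longrightarrow> tensor_lift (add_monoid C) (\<lambda>x y. \<epsilon> y \<odot>\<^bsub>C\<^esub> x) (\<Delta> c) = c"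

locale bialgebra = coalgebra K H \<Delta> \<epsilon> + H: ring H
  for K (structure) and H (structure) and \<Delta> and \<epsilon> +
  assumes smult_mult_left: "\<lbrakk>a \<in> carrier K; x \<in> carrier H; y \<in> carrier H\<rbrakk> \<Longrightarrow>
      (a \<odot>\<^bsub>H\<^esub> x) \<otimes>\<^bsub>H\<^esub> y = a \<odot>\<^bsub>H\<^esub> (x \<otimes>\<^bsub>H\<^esub> y)"
    and smult_mult_right: "\<lbrakk>a \<in> carrier K; x \<in> carrier H; y \<in> carrier H\<rbrakk> \<Longrightarrow>
      x \<otimes>\<^bsub>H\<^esub> (a \<odot>\<^bsub>H\<^esub> y) = a \<odot>\<^bsub>H\<^esub> (x \<otimes>\<^bsub>H\<^esub> y)"
    and comult_ring_hom: "\<Delta> \<in> ring_hom H (tensor K H H)"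
    and counit_ring_hom: "\<epsilon> \<in> ring_hom H K"

definition convolution ::
  "('k, 'x) ring_scheme \<Rightarrow> ('h \<Rightarrow> ('h \<times> 'h \<Rightarrow>\<^sub>0 int) set) \<Rightarrow> ('h \<Rightarrow> 'k) \<Rightarrow> ('h \<Rightarrow> 'k) \<Rightarrow> 'h \<Rightarrow> 'k" where
  "convolution K \<Delta> f g h = tensor_lift (add_monoid K) (\<lambda>x y. f x \<otimes>\<^bsub>K\<^esub> g y) (\<Delta> h)"

definition dual_counit :: "('k, 'h, 'y) module_scheme \<Rightarrow> ('h \<Rightarrow> 'k) \<Rightarrow> 'k" where
  "dual_counit H f = f \<one>\<^bsub>H\<^esub>"

definition left_cointegral ::
  "('k, 'x) ring_scheme \<Rightarrow> ('k, 'h, 'y) module_scheme \<Rightarrow> ('h \<Rightarrow> ('h \<times> 'h \<Rightarrow>\<^sub>0 int) set)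
    \<Rightarrow> ('h \<Rightarrow> 'k) \<Rightarrow> bool" where
  "left_cointegral K H \<Delta> l \<longleftrightarrow> l \<in> dual K H \<and>
     (\<forall>f \<in> dual K H. \<forall>h \<in> carrier H.
        convolution K \<Delta> f l h = dual_counit H f \<otimes>\<^bsub>K\<^esub> l h)"

text \<open>The cointegral, usually written \<open>\<lambda>\<close>, is called \<open>l\<close> here.\<close>

locale cosemisimple_bialgebra = bialgebra K H \<Delta> \<epsilon>
  for K (structure) and H (structure) and \<Delta> and \<epsilon> +
  fixes l :: "'c \<Rightarrow> 'a"
  assumes cointegral: "left_cointegral K H \<Delta> l"
    and cointegral_normalized: "dual_counit H l = \<one>\<^bsub>K\<^esub>"

locale left_comodule = H: coalgebra K H \<Delta> \<epsilon> + M: vectorspace K M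
  for K (structure) and H (structure) and \<Delta> and \<epsilon> and M (structure) +
  fixes \<rho> :: "'e \<Rightarrow> ('c \<times> 'e \<Rightarrow>\<^sub>0 int) set"
  assumes coaction_linear: "\<rho> \<in> module_hom K M (tensor K H M)"
    and coaction_coassoc: "m \<in> carrier M \<Longrightarrow>
      tensor_assoc K H H M (tensor_map K (tensor K H H) M \<Delta> id (\<rho> m)) =
      tensor_map K H (tensor K H M) id \<rho> (\<rho> m)"
    and coaction_counit: "m \<in> carrier M \<Longrightarrow>
      tensor_lift (add_monoid M) (\<lambda>h n. \<epsilon> h \<odot>\<^bsub>M\<^esub> n) (\<rho> m) = m"


section \<open>Rota-Baxter structures\<close>

locale rota_baxter_paired_comodule = left_comodule K H \<Delta> \<epsilon> M \<rho>
  for K (structure) and H (structure) and \<Delta> and \<epsilon> and M (structure) and \<rho> +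
  fixes \<mu> :: 'a and P :: "'c \<Rightarrow> 'c" and T :: "'e \<Rightarrow> 'e"
  assumes weight: "\<mu> \<in> carrier K"
    and P_linear: "P \<in> module_hom K H H"
    and T_linear: "T \<in> module_hom K M M"
    and rota_baxter: "m \<in> carrier M \<Longrightarrow>
      tensor_map K H M P T (\<rho> m) =
      tensor_map K H M P id (\<rho> (T m)) \<oplus>\<^bsub>tensor K H M\<^esub> tensor_map K H M id T (\<rho> (T m))
        \<oplus>\<^bsub>tensor K H M\<^esub> (\<mu> \<odot>\<^bsub>tensor K H M\<^esub> \<rho> (T m))"

locale rota_baxter_coalgebra = coalgebra K C \<Delta> \<epsilon>
  for K (structure) and C (structure) and \<Delta> and \<epsilon> +
  fixes \<mu> :: 'a and P :: "'c \<Rightarrow> 'c"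
  assumes weight: "\<mu> \<in> carrier K"
    and P_linear: "P \<in> module_hom K C C"
    and rota_baxter: "c \<in> carrier C \<Longrightarrow>
      tensor_map K C C P P (\<Delta> c) =
      tensor_map K C C P id (\<Delta> (P c)) \<oplus>\<^bsub>tensor K C C\<^esub> tensor_map K C C id P (\<Delta> (P c))
        \<oplus>\<^bsub>tensor K C C\<^esub> (\<mu> \<odot>\<^bsub>tensor K C C\<^esub> \<Delta> (P c))"

end

theory Submission
  imports Defs
begin

text \<open>
  Contracting coassociativity with \<open>\<lambda>\<close> in the first factor gives \<open>\<rho> T = (P \<otimes> id) \<rho>\<close>. Over a field
  the cointegral identity says \<open>h\<^sub>1 \<lambda>(h\<^sub>2) = \<lambda>(h) 1\<close>, so contracting in the second factor gives
  \<open>(id \<otimes> T) \<rho>(m) = 1 \<otimes> T m\<close>. As \<open>\<lambda>(1) = 1\<close>, moreover \<open>P 1 = 1\<close>, \<open>\<lambda> P = \<lambda> \<lambda> = \<lambda>\<close> and hence \<open>T T = T\<close>.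
  Therefore \<open>(P \<otimes> T) \<rho>(m) = 1 \<otimes> T m\<close>, \<open>(P \<otimes> id) \<rho>(T m) = \<rho>(T m)\<close> and
  \<open>(id \<otimes> T) \<rho>(T m) = 1 \<otimes> T m\<close>, which is the Rota-Baxter identity of weight \<open>-1\<close>. The coalgebra
  statement is the case of \<open>H\<close> as a comodule over itself, where \<open>T = P\<close>.
\<close>

section \<open>The universal property of the tensor product\<close>

text \<open>With u = 1 \<otimes> T m and v = \<rho>(T m) the Rota-Baxter identity becomes u = v + u
  + \<mu> v, which explains the weight: \<mu> = -1 makes the terms v cancel. The unit enters through
  \<Delta>(1) = 1 \<otimes> 1, which together with \<lambda>(1) = 1 yields P 1 = 1, and \<lambda>
  \<lambda> = \<lambda> is the cointegral identity taken at f = \<lambda>. What shapes the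
  development is that a tensor is a coset and \<open>tensor_lift\<close> reads a value off it with
  \<open>the_elem\<close>. A Sweedler computation is therefore meaningful only for balanced
  functions. Each such computation is recast as an equality of linear maps on a tensor product, to
  be tested on pure tensors; a contraction is one linear map on H \<otimes> (H \<otimes> M), applied
  to both sides of coassociativity. The cointegral identity, moreover, is an equation between
  scalars, while contracting the second factor needs an equation in H. Since H may be
  infinite-dimensional, Zorn's lemma supplies the functionals that bridge the two.\<close>

text \<open>The three laws mirror the three families of \<open>tensor_relators\<close>, with values
  in a multiplicative group. A group as target, rather than a module, allows its use for the scalar
  action on tensors before that action is known to give a module.\<close>

definition balanced ::
  "('k, 'x) ring_scheme \<Rightarrow> ('k, 'a, 'y) module_scheme \<Rightarrow> ('k, 'b, 'z) module_scheme
    \<Rightarrow> ('c, 'w) monoid_scheme \<Rightarrow> ('a \<Rightarrow> 'b \<Rightarrow> 'c) \<Rightarrow> bool" where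
  "balanced K M N G f \<longleftrightarrow>
     (\<forall>x \<in> carrier M. \<forall>y \<in> carrier N. f x y \<in> carrier G) \<and>
     (\<forall>x \<in> carrier M. \<forall>x' \<in> carrier M. \<forall>y \<in> carrier N.
        f (x \<oplus>\<^bsub>M\<^esub> x') y = f x y \<otimes>\<^bsub>G\<^esub> f x' y) \<and>
     (\<forall>x \<in> carrier M. \<forall>y \<in> carrier N. \<forall>y' \<in> carrier N.
        f x (y \<oplus>\<^bsub>N\<^esub> y') = f x y \<otimes>\<^bsub>G\<^esub> f x y') \<and>
     (\<forall>a \<in> carrier K. \<forall>x \<in> carrier M. \<forall>y \<in> carrier N.
        f (a \<odot>\<^bsub>M\<^esub> x) y = f x (a \<odot>\<^bsub>N\<^esub> y))"

text \<open>The universal property of the free abelian group yields a homomorphism without a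
  formula; this expansion identifies it with the explicit product inside
  \<open>tensor_lift\<close>.\<close>

lemma hom_free_Abelian_group_expansion:
  assumes G: "comm_group G" and h: "h \<in> hom (free_Abelian_group S) G"
    and c: "Poly_Mapping.keys c \<subseteq> S"
  shows "h c = finprod G (\<lambda>p. h (frag_of p) [^]\<^bsub>G\<^esub> Poly_Mapping.lookup c p) (Poly_Mapping.keys c)"
proof -
  interpret G: comm_group G by fact
  interpret h: group_hom "free_Abelian_group S" G h
    by (simp add: group_hom_def group_hom_axioms_def h G.is_group)
  \<comment> \<open>The coefficients \<open>a\<close> are detached from \<open>c\<close> so that the
    index set can shrink in the induction. The support condition is carried along because the
    homomorphism law applies only inside the carrier.\<close>
  have "Poly_Mapping.keys (\<Sum>i\<in>A. frag_cmul (a i) (frag_of i)) \<subseteq> S \<and>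
      h (\<Sum>i\<in>A. frag_cmul (a i) (frag_of i)) = finprod G (\<lambda>p. h (frag_of p) [^]\<^bsub>G\<^esub> a p) A"
    if "finite A" "A \<subseteq> S" for A and a :: "_ \<Rightarrow> int"
    using that
  proof (induction A)
    case empty
    then show ?case using h.hom_one by simp
  next
    case (insert i A)
    then have i: "Poly_Mapping.keys (frag_cmul (a i) (frag_of i)) \<subseteq> S"
      by (auto dest: subsetD [OF keys_cmul])
    have hi: "h (frag_of j) \<in> carrier G" if "j \<in> S" for j
      using that by (intro h.hom_closed) simp
    have "h (frag_cmul (a i) (frag_of i)) = h (frag_of i) [^]\<^bsub>G\<^esub> a i"
      using h.hom_int_pow [of "frag_of i" "a i"] insert by simp
    moreover have "h (frag_cmul (a i) (frag_of i) + (\<Sum>i\<in>A. frag_cmul (a i) (frag_of i))) =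
        h (frag_cmul (a i) (frag_of i)) \<otimes>\<^bsub>G\<^esub> h (\<Sum>i\<in>A. frag_cmul (a i) (frag_of i))"
      using h.hom_mult [of "frag_cmul (a i) (frag_of i)" "\<Sum>i\<in>A. frag_cmul (a i) (frag_of i)"]
        insert i by simp
    ultimately show ?case
      using insert i hi by (auto simp: subset_iff dest!: subsetD [OF keys_add])
  qed
  from this [OF finite_keys c, of "Poly_Mapping.lookup c"] show ?thesis
    by (simp flip: frag_extend_def frag_expansion)
qed

lemma tensor_relators_subset:
  assumes "module K M" "module K N"
  shows "tensor_relators K M N \<subseteq> carrier (free_Abelian_group (carrier M \<times> carrier N))"
proof -
  interpret M: module K M by fact
  interpret N: module K N by fact
  show ?thesis
    unfolding tensor_relators_def
    by (auto dest!: subsetD [OF keys_diff])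
qed

lemma tensor_kernel_normal:
  assumes "module K M" "module K N"
  shows "tensor_kernel K M N \<lhd> free_Abelian_group (carrier M \<times> carrier N)"
  unfolding tensor_kernel_def
  by (intro comm_group.subgroup_imp_normal abelian_free_Abelian_group
      group.generate_is_subgroup group_free_Abelian_group tensor_relators_subset assms)

lemma tensor_group_comm_group:
  assumes "module K M" "module K N"
  shows "comm_group (tensor_group K M N)"
  unfolding tensor_group_def
  by (intro comm_group.abelian_FactGroup abelian_free_Abelian_group
      normal_imp_subgroup tensor_kernel_normal assms)

lemma pure_tensor_in_tensor_group:
  assumes "x \<in> carrier M" "y \<in> carrier N"
  shows "pure_tensor K M N x y \<in> carrier (tensor_group K M N)"
  unfolding tensor_group_def pure_tensor_def carrier_FactGroup using assms by auto

text \<open>Pure tensors generate the tensor group: composing with the quotient map reduces the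
  claim to the free group, where it passes from generators to differences.\<close>

lemma tensor_group_hom_eqI:
  assumes mods: "module K M" "module K N" and G: "group G"
    and h: "h \<in> hom (tensor_group K M N) G" "h' \<in> hom (tensor_group K M N) G"
    and eq: "\<And>x y. x \<in> carrier M \<Longrightarrow> y \<in> carrier N \<Longrightarrow>
      h (pure_tensor K M N x y) = h' (pure_tensor K M N x y)"
    and X: "X \<in> carrier (tensor_group K M N)"
  shows "h X = h' X"
proof -
  let ?F = "free_Abelian_group (carrier M \<times> carrier N)"
  let ?q = "\<lambda>c. tensor_kernel K M N #>\<^bsub>?F\<^esub> c"
  have q: "?q \<in> hom ?F (tensor_group K M N)"
    unfolding tensor_group_def
    by (rule normal.r_coset_hom_Mod [OF tensor_kernel_normal [OF mods]])
  interpret g: group_hom ?F G "h \<circ> ?q"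
    unfolding group_hom_def group_hom_axioms_def using hom_compose [OF q h(1)] G by simp
  interpret g': group_hom ?F G "h' \<circ> ?q"
    unfolding group_hom_def group_hom_axioms_def using hom_compose [OF q h(2)] G by simp
  have "(h \<circ> ?q) c = (h' \<circ> ?q) c" if "Poly_Mapping.keys c \<subseteq> carrier M \<times> carrier N" for c
  proof (rule free_Abelian_group_induct [OF that])
    show "(h \<circ> ?q) 0 = (h' \<circ> ?q) 0"
      using g.hom_one g'.hom_one by simp
  next
    fix c d :: "_ \<Rightarrow>\<^sub>0 int"
    assume c: "Poly_Mapping.keys c \<subseteq> carrier M \<times> carrier N" "(h \<circ> ?q) c = (h' \<circ> ?q) c"
      and d: "Poly_Mapping.keys d \<subseteq> carrier M \<times> carrier N" "(h \<circ> ?q) d = (h' \<circ> ?q) d"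
    have cd: "c \<in> carrier ?F" "d \<in> carrier ?F" "inv\<^bsub>?F\<^esub> d \<in> carrier ?F"
      and diff: "c - d = c \<otimes>\<^bsub>?F\<^esub> inv\<^bsub>?F\<^esub> d"
      using c d by simp_all
    show "(h \<circ> ?q) (c - d) = (h' \<circ> ?q) (c - d)"
      unfolding diff g.hom_mult [OF cd(1,3)] g'.hom_mult [OF cd(1,3)]
        g.hom_inv [OF cd(2)] g'.hom_inv [OF cd(2)] c(2) d(2) ..
  next
    fix p assume "p \<in> carrier M \<times> carrier N"
    then show "(h \<circ> ?q) (frag_of p) = (h' \<circ> ?q) (frag_of p)"
      using eq [of "fst p" "snd p"] by (auto simp: pure_tensor_def)
  qed
  moreover obtain c where "Poly_Mapping.keys c \<subseteq> carrier M \<times> carrier N" "X = ?q c"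
    using X by (auto simp: tensor_group_def carrier_FactGroup)
  ultimately show ?thesis by simp
qed

text \<open>Freeness extends \<open>f\<close> to formal combinations, balancedness sends the
  relators to the identity, and so the extension is constant on cosets. This is what makes
  \<open>the_elem\<close> in \<open>tensor_lift\<close> well defined.\<close>

lemma tensor_lift_universal:
  assumes mods: "module K M" "module K N" and G: "comm_group G" and f: "balanced K M N G f"
  shows tensor_lift_hom: "tensor_lift G f \<in> hom (tensor_group K M N) G"
    and tensor_lift_pure_group: "\<And>x y. x \<in> carrier M \<Longrightarrow> y \<in> carrier N \<Longrightarrow>
      tensor_lift G f (pure_tensor K M N x y) = f x y"
proof -
  interpret M: module K M by fact
  interpret N: module K N by fact
  interpret G: comm_group G by fact
  let ?S = "carrier M \<times> carrier N"
  let ?F = "free_Abelian_group ?S"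
  let ?N = "tensor_kernel K M N"
  interpret N: normal ?N ?F by (rule tensor_kernel_normal [OF mods])
  have fc: "(\<lambda>p. f (fst p) (snd p)) ` ?S \<subseteq> carrier G"
    using f by (auto simp: balanced_def)
  obtain h where h: "h \<in> hom ?F G" and hf: "\<And>p. p \<in> ?S \<Longrightarrow> h (frag_of p) = f (fst p) (snd p)"
    using G.free_Abelian_group_universal [OF fc] by metis
  interpret h: group_hom ?F G h
    by (simp add: group_hom_def group_hom_axioms_def h G.is_group)
  have hdiff: "h (a - b) = h a \<otimes>\<^bsub>G\<^esub> inv\<^bsub>G\<^esub> h b" if "Poly_Mapping.keys a \<subseteq> ?S" "Poly_Mapping.keys b \<subseteq> ?S" for a b
    using h.hom_mult [of a "inv\<^bsub>?F\<^esub> b"] h.hom_inv [of b] that by simp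
  have kd: "Poly_Mapping.keys (a - b) \<subseteq> ?S" if "Poly_Mapping.keys a \<subseteq> ?S" "Poly_Mapping.keys b \<subseteq> ?S"
    for a b :: "_ \<Rightarrow>\<^sub>0 int"
    by (rule order_trans [OF keys_diff Un_least [OF that]])
  have "tensor_relators K M N \<subseteq> kernel ?F G h"
  proof
    fix r assume r: "r \<in> tensor_relators K M N"
    have rc: "r \<in> carrier ?F" using tensor_relators_subset [OF mods] r by blast
    \<comment> \<open>Shape of the image of an additivity relator: the value at a sum, divided by
      the two values at the summands.\<close>
    have cancel: "(a \<otimes>\<^bsub>G\<^esub> b) \<otimes>\<^bsub>G\<^esub> inv\<^bsub>G\<^esub> a \<otimes>\<^bsub>G\<^esub> inv\<^bsub>G\<^esub> b = \<one>\<^bsub>G\<^esub>"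
      if "a \<in> carrier G" "b \<in> carrier G" for a b
    proof -
      have "(a \<otimes>\<^bsub>G\<^esub> b) \<otimes>\<^bsub>G\<^esub> inv\<^bsub>G\<^esub> a \<otimes>\<^bsub>G\<^esub> inv\<^bsub>G\<^esub> b = (a \<otimes>\<^bsub>G\<^esub> b) \<otimes>\<^bsub>G\<^esub> inv\<^bsub>G\<^esub> (b \<otimes>\<^bsub>G\<^esub> a)"
        using that by (simp add: G.m_assoc G.inv_mult_group)
      also have "\<dots> = \<one>\<^bsub>G\<^esub>"
        using that by (simp add: G.m_comm [of b a])
      finally show ?thesis .
    qed
    from r consider
        (l) x x' y where "r = frag_of (x \<oplus>\<^bsub>M\<^esub> x', y) - frag_of (x, y) - frag_of (x', y)"
          "x \<in> carrier M" "x' \<in> carrier M" "y \<in> carrier N"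
      | (r) x y y' where "r = frag_of (x, y \<oplus>\<^bsub>N\<^esub> y') - frag_of (x, y) - frag_of (x, y')"
          "x \<in> carrier M" "y \<in> carrier N" "y' \<in> carrier N"
      | (b) a x y where "r = frag_of (a \<odot>\<^bsub>M\<^esub> x, y) - frag_of (x, a \<odot>\<^bsub>N\<^esub> y)"
          "a \<in> carrier K" "x \<in> carrier M" "y \<in> carrier N"
      unfolding tensor_relators_def by blast
    then have "h r = \<one>\<^bsub>G\<^esub>"
    proof cases
      case l
      then show ?thesis
        using f by (simp add: hdiff kd hf cancel balanced_def)
    next
      case r
      then show ?thesis
        using f by (simp add: hdiff kd hf cancel balanced_def)
    next
      case b
      moreover from b have "f (a \<odot>\<^bsub>M\<^esub> x) y = f x (a \<odot>\<^bsub>N\<^esub> y)" "f x (a \<odot>\<^bsub>N\<^esub> y) \<in> carrier G"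
        using f by (auto simp: balanced_def)
      ultimately show ?thesis by (simp add: hdiff hf)
    qed
    with rc show "r \<in> kernel ?F G h" by (simp add: kernel_def)
  qed
  then have ker: "?N \<subseteq> kernel ?F G h"
    unfolding tensor_kernel_def
    by (intro group.generate_subgroup_incl h.subgroup_kernel group_free_Abelian_group)
  have lift: "tensor_lift G f (?N #>\<^bsub>?F\<^esub> c) = h c" if c: "c \<in> carrier ?F" for c
  proof -
    let ?h = "\<lambda>c. finprod G (\<lambda>p. f (fst p) (snd p) [^]\<^bsub>G\<^esub> Poly_Mapping.lookup c p) (Poly_Mapping.keys c)"
    have h_eq: "?h d = h d" if "d \<in> carrier ?F" for d
    proof -
      have d: "Poly_Mapping.keys d \<subseteq> ?S" using that by simp
      show ?thesis
        unfolding hom_free_Abelian_group_expansion [OF G h d]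
      proof (rule G.finprod_cong')
        have carr: "f (fst p) (snd p) \<in> carrier G" if "p \<in> ?S" for p
          using fc that by blast
        then show "(\<lambda>p. h (frag_of p) [^]\<^bsub>G\<^esub> Poly_Mapping.lookup d p) \<in> Poly_Mapping.keys d \<rightarrow> carrier G"
          using d hf by auto
        show "f (fst p) (snd p) [^]\<^bsub>G\<^esub> Poly_Mapping.lookup d p = h (frag_of p) [^]\<^bsub>G\<^esub> Poly_Mapping.lookup d p"
          if "p \<in> Poly_Mapping.keys d" for p
          using hf [OF subsetD [OF d that]] by simp
      qed simp
    qed
    \<comment> \<open>All representatives of a coset give the same value, so the image under the
      formula \<open>?h\<close> is a singleton.\<close>
    have const: "?h d = h c" if "d \<in> ?N #>\<^bsub>?F\<^esub> c" for d
    proof -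
      from that obtain n where n: "n \<in> ?N" "d = n \<otimes>\<^bsub>?F\<^esub> c"
        by (auto simp: r_coset_def)
      have nc: "n \<in> carrier ?F" "h n = \<one>\<^bsub>G\<^esub>"
        using n ker by (auto simp: kernel_def)
      have "d \<in> carrier ?F" "h d = h c"
        unfolding n(2) h.hom_mult [OF nc(1) c] nc(2)
        using monoid.m_closed [OF group.is_monoid [OF group_free_Abelian_group] nc(1) c]
          G.l_one [OF h.hom_closed [OF c]] by blast+
      then show ?thesis using h_eq by simp
    qed
    have "c \<in> ?N #>\<^bsub>?F\<^esub> c"
      by (rule group.rcos_self [OF group_free_Abelian_group c N.is_subgroup])
    then have "the_elem (?h ` (?N #>\<^bsub>?F\<^esub> c)) = ?h c"
      by (intro the_elem_image_unique) (auto simp: const)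
    then show ?thesis unfolding tensor_lift_def by (simp add: h_eq [OF c])
  qed
  show "tensor_lift G f \<in> hom (tensor_group K M N) G"
  proof (rule homI)
    fix X Y assume "X \<in> carrier (tensor_group K M N)" "Y \<in> carrier (tensor_group K M N)"
    then obtain c d where c: "c \<in> carrier ?F" "X = ?N #>\<^bsub>?F\<^esub> c" and d: "d \<in> carrier ?F" "Y = ?N #>\<^bsub>?F\<^esub> d"
      unfolding tensor_group_def carrier_FactGroup by blast
    have "X \<otimes>\<^bsub>tensor_group K M N\<^esub> Y = ?N #>\<^bsub>?F\<^esub> (c \<otimes>\<^bsub>?F\<^esub> d)"
      using c d by (simp only: tensor_group_def mult_FactGroup N.rcos_sum)
    moreover have "c \<otimes>\<^bsub>?F\<^esub> d \<in> carrier ?F"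
      using c d by (meson group.subgroup_self group_free_Abelian_group subgroup.m_closed)
    ultimately show "tensor_lift G f (X \<otimes>\<^bsub>tensor_group K M N\<^esub> Y) = tensor_lift G f X \<otimes>\<^bsub>G\<^esub> tensor_lift G f Y"
      using c d by (simp only: lift h.hom_mult)
  next
    fix X assume "X \<in> carrier (tensor_group K M N)"
    then obtain c where c: "c \<in> carrier ?F" "X = ?N #>\<^bsub>?F\<^esub> c"
      unfolding tensor_group_def carrier_FactGroup by blast
    then show "tensor_lift G f X \<in> carrier G"
      by (simp only: lift h.hom_closed)
  qed
  show "tensor_lift G f (pure_tensor K M N x y) = f x y" if "x \<in> carrier M" "y \<in> carrier N" for x y
    using that by (simp add: pure_tensor_def lift hf)
qed

text \<open>Each law holds because the difference of the two formal combinations is itself a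
  relator, so that their cosets coincide.\<close>

lemma pure_tensor_balanced:
  assumes mods: "module K M" "module K N"
  shows "balanced K M N (tensor_group K M N) (pure_tensor K M N)"
proof -
  interpret M: module K M by fact
  interpret N: module K N by fact
  let ?S = "carrier M \<times> carrier N"
  let ?F = "free_Abelian_group ?S"
  let ?N = "tensor_kernel K M N"
  interpret N: normal ?N ?F by (rule tensor_kernel_normal [OF mods])
  have eq: "?N #>\<^bsub>?F\<^esub> a = ?N #>\<^bsub>?F\<^esub> b"
    if "a - b \<in> tensor_relators K M N" "Poly_Mapping.keys a \<subseteq> ?S" "Poly_Mapping.keys b \<subseteq> ?S" for a b
  proof -
    have "a - b \<in> ?N"
      unfolding tensor_kernel_def by (rule generate.incl [OF that(1)])
    then have "a \<in> ?N #>\<^bsub>?F\<^esub> b"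
      by (auto simp: r_coset_def intro!: bexI [of _ "a - b"])
    then show ?thesis
      using that N.is_subgroup group.repr_independence [OF group_free_Abelian_group, of a ?S ?N b] by simp
  qed
  have add: "(?N #>\<^bsub>?F\<^esub> frag_of p) \<otimes>\<^bsub>tensor_group K M N\<^esub> (?N #>\<^bsub>?F\<^esub> frag_of q) = ?N #>\<^bsub>?F\<^esub> (frag_of p + frag_of q)"
    if "p \<in> ?S" "q \<in> ?S" for p q
    using N.rcos_sum [of "frag_of p" "frag_of q"] that by (simp add: tensor_group_def)
  show ?thesis
    unfolding balanced_def
  proof (intro conjI ballI)
    show "pure_tensor K M N x y \<in> carrier (tensor_group K M N)"
      if "x \<in> carrier M" "y \<in> carrier N" for x y
      by (rule pure_tensor_in_tensor_group [OF that])
    show "pure_tensor K M N (x \<oplus>\<^bsub>M\<^esub> x') y =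
        pure_tensor K M N x y \<otimes>\<^bsub>tensor_group K M N\<^esub> pure_tensor K M N x' y"
      if "x \<in> carrier M" "x' \<in> carrier M" "y \<in> carrier N" for x x' y
      using that unfolding pure_tensor_def
      by (subst add, simp, simp, intro eq) (auto dest!: subsetD [OF keys_add] simp: tensor_relators_def diff_diff_eq)
    show "pure_tensor K M N x (y \<oplus>\<^bsub>N\<^esub> y') =
        pure_tensor K M N x y \<otimes>\<^bsub>tensor_group K M N\<^esub> pure_tensor K M N x y'"
      if "x \<in> carrier M" "y \<in> carrier N" "y' \<in> carrier N" for x y y'
      using that unfolding pure_tensor_def
      by (subst add, simp, simp, intro eq) (auto dest!: subsetD [OF keys_add] simp: tensor_relators_def diff_diff_eq)
    show "pure_tensor K M N (a \<odot>\<^bsub>M\<^esub> x) y = pure_tensor K M N x (a \<odot>\<^bsub>N\<^esub> y)"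
      if "a \<in> carrier K" "x \<in> carrier M" "y \<in> carrier N" for a x y
      using that unfolding pure_tensor_def by (intro eq) (auto simp: tensor_relators_def)
  qed
qed

section \<open>The \<open>K\<close>-module structure on the tensor product\<close>

lemma carrier_tensor [simp]: "carrier (tensor K M N) = carrier (tensor_group K M N)"
  by (simp add: tensor_def)

lemma add_tensor: "X \<oplus>\<^bsub>tensor K M N\<^esub> Y = X \<otimes>\<^bsub>tensor_group K M N\<^esub> Y"
  by (simp add: tensor_def)

lemma smult_pure_tensor_balanced:
  assumes mods: "module K M" "module K N" and a: "a \<in> carrier K"
  shows "balanced K M N (tensor_group K M N) (\<lambda>x y. pure_tensor K M N (a \<odot>\<^bsub>M\<^esub> x) y)"
proof -
  interpret M: module K M by fact
  interpret N: module K N by fact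
  have p: "balanced K M N (tensor_group K M N) (pure_tensor K M N)"
    by (rule pure_tensor_balanced [OF mods])
  \<comment> \<open>Commutativity of \<open>K\<close> lets the acting scalar pass the scalar being
    balanced.\<close>
  have "a \<odot>\<^bsub>M\<^esub> (b \<odot>\<^bsub>M\<^esub> x) = b \<odot>\<^bsub>M\<^esub> (a \<odot>\<^bsub>M\<^esub> x)" if "b \<in> carrier K" "x \<in> carrier M" for b x
    using a that by (simp add: M.R.m_comm flip: M.smult_assoc1)
  then show ?thesis
    using p a unfolding balanced_def by (simp add: M.smult_r_distr)
qed

lemma smult_tensor_hom:
  assumes "module K M" "module K N" "a \<in> carrier K"
  shows "(\<lambda>X. a \<odot>\<^bsub>tensor K M N\<^esub> X) \<in> hom (tensor_group K M N) (tensor_group K M N)"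
  using tensor_lift_hom [OF assms(1,2) tensor_group_comm_group smult_pure_tensor_balanced] assms
  by (simp add: tensor_def)

lemma smult_pure_tensor:
  assumes "module K M" "module K N" "a \<in> carrier K" "x \<in> carrier M" "y \<in> carrier N"
  shows "a \<odot>\<^bsub>tensor K M N\<^esub> pure_tensor K M N x y = pure_tensor K M N (a \<odot>\<^bsub>M\<^esub> x) y"
  using tensor_lift_pure_group [OF assms(1,2) tensor_group_comm_group smult_pure_tensor_balanced] assms
  by (simp add: tensor_def)

text \<open>Additivity in the tensor is \<open>smult_tensor_hom\<close>. Each remaining scalar law
  equates two endomorphisms of the tensor group and so need only be checked on pure tensors; for the
  sum of scalars, commutativity of the group makes the pointwise product a homomorphism.\<close>

lemma tensor_module:
  assumes mods: "module K M" "module K N"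
  shows "module K (tensor K M N)"
proof -
  interpret M: module K M by fact
  interpret N: module K N by fact
  interpret T: comm_group "tensor_group K M N" by (rule tensor_group_comm_group [OF mods])
  note p = pure_tensor_balanced [OF mods] and sh = smult_tensor_hom [OF mods]
    and eqI = tensor_group_hom_eqI [OF mods T.is_group]
  show ?thesis
  proof (rule moduleI)
    show "cring K" by (rule M.R.cring_axioms)
    show "abelian_group (tensor K M N)"
    proof (rule abelian_groupI)
      show "\<exists>Y \<in> carrier (tensor K M N). Y \<oplus>\<^bsub>tensor K M N\<^esub> X = \<zero>\<^bsub>tensor K M N\<^esub>"
        if "X \<in> carrier (tensor K M N)" for X
        using that T.l_inv_ex by (simp add: tensor_def)
    qed (simp_all add: tensor_def T.m_ac)
    fix a X assume a: "a \<in> carrier K" and X: "X \<in> carrier (tensor K M N)"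
    show "a \<odot>\<^bsub>tensor K M N\<^esub> X \<in> carrier (tensor K M N)"
      using hom_in_carrier [OF sh [OF a]] X by simp
    show "a \<odot>\<^bsub>tensor K M N\<^esub> (X \<oplus>\<^bsub>tensor K M N\<^esub> Y) =
        a \<odot>\<^bsub>tensor K M N\<^esub> X \<oplus>\<^bsub>tensor K M N\<^esub> a \<odot>\<^bsub>tensor K M N\<^esub> Y"
      if "Y \<in> carrier (tensor K M N)" for Y
      using hom_mult [OF sh [OF a]] X that by (simp add: add_tensor)
    fix b assume b: "b \<in> carrier K"
    show "(a \<oplus>\<^bsub>K\<^esub> b) \<odot>\<^bsub>tensor K M N\<^esub> X =
        a \<odot>\<^bsub>tensor K M N\<^esub> X \<oplus>\<^bsub>tensor K M N\<^esub> b \<odot>\<^bsub>tensor K M N\<^esub> X"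
      unfolding add_tensor
    proof (rule eqI [where h = "\<lambda>X. (a \<oplus>\<^bsub>K\<^esub> b) \<odot>\<^bsub>tensor K M N\<^esub> X"
          and h' = "\<lambda>X. (a \<odot>\<^bsub>tensor K M N\<^esub> X) \<otimes>\<^bsub>tensor_group K M N\<^esub> (b \<odot>\<^bsub>tensor K M N\<^esub> X)"])
      show "(\<lambda>X. (a \<oplus>\<^bsub>K\<^esub> b) \<odot>\<^bsub>tensor K M N\<^esub> X) \<in> hom (tensor_group K M N) (tensor_group K M N)"
        using a b by (intro sh) simp
      show "(\<lambda>X. (a \<odot>\<^bsub>tensor K M N\<^esub> X) \<otimes>\<^bsub>tensor_group K M N\<^esub> (b \<odot>\<^bsub>tensor K M N\<^esub> X))
          \<in> hom (tensor_group K M N) (tensor_group K M N)"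
        using a b by (intro T.hom_group_mult sh T.is_group)
      show "X \<in> carrier (tensor_group K M N)" using X by simp
      show "(a \<oplus>\<^bsub>K\<^esub> b) \<odot>\<^bsub>tensor K M N\<^esub> pure_tensor K M N x y =
          (a \<odot>\<^bsub>tensor K M N\<^esub> pure_tensor K M N x y) \<otimes>\<^bsub>tensor_group K M N\<^esub>
          (b \<odot>\<^bsub>tensor K M N\<^esub> pure_tensor K M N x y)"
        if "x \<in> carrier M" "y \<in> carrier N" for x y
        using p a b that unfolding balanced_def
        by (simp add: smult_pure_tensor [OF mods] M.smult_l_distr)
    qed
    show "(a \<otimes>\<^bsub>K\<^esub> b) \<odot>\<^bsub>tensor K M N\<^esub> X = a \<odot>\<^bsub>tensor K M N\<^esub> (b \<odot>\<^bsub>tensor K M N\<^esub> X)"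
    proof (rule eqI [where h = "\<lambda>X. (a \<otimes>\<^bsub>K\<^esub> b) \<odot>\<^bsub>tensor K M N\<^esub> X" and h' = "\<lambda>X. a \<odot>\<^bsub>tensor K M N\<^esub> (b \<odot>\<^bsub>tensor K M N\<^esub> X)"])
      show "(\<lambda>X. (a \<otimes>\<^bsub>K\<^esub> b) \<odot>\<^bsub>tensor K M N\<^esub> X) \<in> hom (tensor_group K M N) (tensor_group K M N)"
        using a b by (intro sh) simp
      show "(\<lambda>X. a \<odot>\<^bsub>tensor K M N\<^esub> (b \<odot>\<^bsub>tensor K M N\<^esub> X)) \<in> hom (tensor_group K M N) (tensor_group K M N)"
        using hom_compose [OF sh [OF b] sh [OF a]] by (simp add: comp_def)
      show "X \<in> carrier (tensor_group K M N)" using X by simp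
      show "(a \<otimes>\<^bsub>K\<^esub> b) \<odot>\<^bsub>tensor K M N\<^esub> pure_tensor K M N x y =
          a \<odot>\<^bsub>tensor K M N\<^esub> (b \<odot>\<^bsub>tensor K M N\<^esub> pure_tensor K M N x y)"
        if "x \<in> carrier M" "y \<in> carrier N" for x y
        using a b that by (simp add: smult_pure_tensor [OF mods] M.smult_assoc1)
    qed
  next
    fix X assume X: "X \<in> carrier (tensor K M N)"
    show "\<one>\<^bsub>K\<^esub> \<odot>\<^bsub>tensor K M N\<^esub> X = X"
    proof (rule eqI)
      show "(\<lambda>X. \<one>\<^bsub>K\<^esub> \<odot>\<^bsub>tensor K M N\<^esub> X) \<in> hom (tensor_group K M N) (tensor_group K M N)"
        by (intro sh) simp
      show "(\<lambda>X. X) \<in> hom (tensor_group K M N) (tensor_group K M N)"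
        by (simp add: hom_def)
      show "X \<in> carrier (tensor_group K M N)" using X by simp
      show "\<one>\<^bsub>K\<^esub> \<odot>\<^bsub>tensor K M N\<^esub> pure_tensor K M N x y = pure_tensor K M N x y"
        if "x \<in> carrier M" "y \<in> carrier N" for x y
        using that by (simp add: smult_pure_tensor [OF mods])
    qed
  qed
qed


section \<open>Linear and bilinear maps\<close>

lemma module_homI:
  assumes "\<And>x. x \<in> carrier M \<Longrightarrow> f x \<in> carrier N"
    and "\<And>x x'. x \<in> carrier M \<Longrightarrow> x' \<in> carrier M \<Longrightarrow> f (x \<oplus>\<^bsub>M\<^esub> x') = f x \<oplus>\<^bsub>N\<^esub> f x'"
    and "\<And>a x. a \<in> carrier K \<Longrightarrow> x \<in> carrier M \<Longrightarrow> f (a \<odot>\<^bsub>M\<^esub> x) = a \<odot>\<^bsub>N\<^esub> f x"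
  shows "f \<in> module_hom K M N"
  using assms by (auto simp: module_hom_def)

lemma module_hom_in_carrier: "f \<in> module_hom K M N \<Longrightarrow> x \<in> carrier M \<Longrightarrow> f x \<in> carrier N"
  by (auto simp: module_hom_def)

lemma module_hom_imp_hom: "f \<in> module_hom K M N \<Longrightarrow> f \<in> hom (add_monoid M) (add_monoid N)"
  by (auto simp: module_hom_def hom_def)

text \<open>Only values on the carrier count in \<open>module_hom\<close>. This later admits maps P
  and T that are prescribed on the carriers alone.\<close>

lemma module_hom_cong:
  assumes "module K M" "f \<in> module_hom K M N" "\<And>x. x \<in> carrier M \<Longrightarrow> g x = f x"
  shows "g \<in> module_hom K M N"
proof -
  interpret module K M by fact
  show ?thesis using assms(2,3) by (auto simp: module_hom_def)
qed

lemma module_hom_id: "(\<lambda>x. x) \<in> module_hom K M M"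
  by (auto simp: module_hom_def)

lemma module_hom_compose:
  "f \<in> module_hom K M N \<Longrightarrow> g \<in> module_hom K N L \<Longrightarrow> (\<lambda>x. g (f x)) \<in> module_hom K M L"
  by (auto simp: module_hom_def Pi_def)

lemma module_hom_plus:
  assumes "module K N" "f \<in> module_hom K M N" "g \<in> module_hom K M N"
  shows "(\<lambda>x. f x \<oplus>\<^bsub>N\<^esub> g x) \<in> module_hom K M N"
proof -
  interpret N: module K N by fact
  note c = assms(2,3) [THEN module_hom_in_carrier]
  show ?thesis
    using assms(2,3) c
    by (intro module_homI) (simp_all add: module_hom_add module_hom_smult N.smult_r_distr N.M.a_ac)
qed

lemma module_hom_scale:
  assumes "module K N" "a \<in> carrier K" "f \<in> module_hom K M N"
  shows "(\<lambda>x. a \<odot>\<^bsub>N\<^esub> f x) \<in> module_hom K M N"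
proof -
  interpret N: module K N by fact
  note c = assms(3) [THEN module_hom_in_carrier]
  have "a \<odot>\<^bsub>N\<^esub> (b \<odot>\<^bsub>N\<^esub> y) = b \<odot>\<^bsub>N\<^esub> (a \<odot>\<^bsub>N\<^esub> y)" if "b \<in> carrier K" "y \<in> carrier N" for b y
    using assms(2) that by (simp add: N.R.m_comm flip: N.smult_assoc1)
  then show ?thesis
    using assms(2,3) c
    by (intro module_homI) (simp_all add: module_hom_add module_hom_smult N.smult_r_distr)
qed

section \<open>Bilinear maps\<close>

definition bilinear_map ::
  "('k, 'x) ring_scheme \<Rightarrow> ('k, 'a, 'u) module_scheme \<Rightarrow> ('k, 'b, 'v) module_scheme
    \<Rightarrow> ('k, 'c, 'w) module_scheme \<Rightarrow> ('a \<Rightarrow> 'b \<Rightarrow> 'c) \<Rightarrow> bool" where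
  "bilinear_map K M N L f \<longleftrightarrow>
     (\<forall>x \<in> carrier M. (\<lambda>y. f x y) \<in> module_hom K N L) \<and>
     (\<forall>y \<in> carrier N. (\<lambda>x. f x y) \<in> module_hom K M L)"

lemma bilinear_mapI:
  assumes "\<And>x. x \<in> carrier M \<Longrightarrow> (\<lambda>y. f x y) \<in> module_hom K N L"
    and "\<And>y. y \<in> carrier N \<Longrightarrow> (\<lambda>x. f x y) \<in> module_hom K M L"
  shows "bilinear_map K M N L f"
  using assms by (simp add: bilinear_map_def)

lemma bilinear_map_left:
  "bilinear_map K M N L f \<Longrightarrow> y \<in> carrier N \<Longrightarrow> (\<lambda>x. f x y) \<in> module_hom K M L"
  by (simp add: bilinear_map_def)

lemma bilinear_map_right:
  "bilinear_map K M N L f \<Longrightarrow> x \<in> carrier M \<Longrightarrow> (\<lambda>y. f x y) \<in> module_hom K N L"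
  by (simp add: bilinear_map_def)

lemma bilinear_map_compose:
  assumes f: "bilinear_map K M' N' L f" and u: "u \<in> module_hom K M M'" and v: "v \<in> module_hom K N N'"
  shows "bilinear_map K M N L (\<lambda>x y. f (u x) (v y))"
proof (rule bilinear_mapI)
  fix x assume "x \<in> carrier M"
  then show "(\<lambda>y. f (u x) (v y)) \<in> module_hom K N L"
    by (rule module_hom_compose [OF v bilinear_map_right [OF f module_hom_in_carrier [OF u]]])
next
  fix y assume "y \<in> carrier N"
  then show "(\<lambda>x. f (u x) (v y)) \<in> module_hom K M L"
    by (rule module_hom_compose [OF u bilinear_map_left [OF f module_hom_in_carrier [OF v]]])
qed

lemma bilinear_map_cong:
  assumes mods: "module K M" "module K N" and f: "bilinear_map K M N L f"
    and eq: "\<And>x y. x \<in> carrier M \<Longrightarrow> y \<in> carrier N \<Longrightarrow> g x y = f x y"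
  shows "bilinear_map K M N L g"
proof (rule bilinear_mapI)
  fix x assume *: "x \<in> carrier M"
  show "(\<lambda>y. g x y) \<in> module_hom K N L"
    by (rule module_hom_cong [OF mods(2) bilinear_map_right [OF f *]]) (simp add: eq *)
next
  fix y assume *: "y \<in> carrier N"
  show "(\<lambda>x. g x y) \<in> module_hom K M L"
    by (rule module_hom_cong [OF mods(1) bilinear_map_left [OF f *]]) (simp add: eq *)
qed

lemma bilinear_map_flip:
  "bilinear_map K M N L f \<Longrightarrow> bilinear_map K N M L (\<lambda>y x. f x y)"
  by (simp add: bilinear_map_def)

lemma bilinear_map_postcompose:
  "bilinear_map K M N L f \<Longrightarrow> g \<in> module_hom K L L' \<Longrightarrow> bilinear_map K M N L' (\<lambda>x y. g (f x y))"
  by (auto simp: bilinear_map_def intro: module_hom_compose)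

lemma bilinear_map_imp_balanced:
  assumes f: "bilinear_map K M N L f"
  shows "balanced K M N (add_monoid L) f"
  using bilinear_map_left [OF f] bilinear_map_right [OF f] unfolding balanced_def
  by (auto simp: module_hom_def Pi_def)

lemma bilinear_map_smult:
  assumes "module K M" "module K N" and u: "u \<in> module_hom K M (ground K)"
  shows "bilinear_map K M N N (\<lambda>x y. u x \<odot>\<^bsub>N\<^esub> y)"
proof -
  interpret N: module K N by fact
  have u1: "u x \<in> carrier K" if "x \<in> carrier M" for x
    using u that by (auto simp: module_hom_def ground_def)
  have u2: "u (x \<oplus>\<^bsub>M\<^esub> x') = u x \<oplus>\<^bsub>K\<^esub> u x'" if "x \<in> carrier M" "x' \<in> carrier M" for x x'
    using u that by (auto simp: module_hom_def ground_def)
  have u3: "u (a \<odot>\<^bsub>M\<^esub> x) = a \<otimes>\<^bsub>K\<^esub> u x" if "x \<in> carrier M" "a \<in> carrier K" for x a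
    using u that by (auto simp: module_hom_def ground_def)
  show ?thesis
    by (intro bilinear_mapI module_hom_scale module_hom_id assms u1 module_homI)
      (simp_all add: u1 u2 u3 N.smult_l_distr N.smult_assoc1)
qed


section \<open>Linear maps on tensor products\<close>

lemma pure_tensor_bilinear:
  assumes mods: "module K M" "module K N"
  shows "bilinear_map K M N (tensor K M N) (pure_tensor K M N)"
proof -
  interpret M: module K M by fact
  interpret N: module K N by fact
  \<comment> \<open>Scalars act through the left factor by definition; balancing carries them to the
    right one, which gives linearity in the second variable.\<close>
  have "a \<odot>\<^bsub>tensor K M N\<^esub> pure_tensor K M N x y = pure_tensor K M N x (a \<odot>\<^bsub>N\<^esub> y)"
    if "a \<in> carrier K" "x \<in> carrier M" "y \<in> carrier N" for a x y
    using pure_tensor_balanced [OF mods] that by (simp add: smult_pure_tensor [OF mods] balanced_def)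
  then show ?thesis
    using pure_tensor_balanced [OF mods]
    by (intro bilinear_mapI module_homI)
      (simp_all add: balanced_def add_tensor smult_pure_tensor [OF mods])
qed

lemma pure_tensor_closed:
  assumes "x \<in> carrier M" "y \<in> carrier N"
  shows "pure_tensor K M N x y \<in> carrier (tensor K M N)"
  using pure_tensor_in_tensor_group [OF assms] by simp

lemma tensor_hom_eqI:
  assumes mods: "module K M" "module K N" "module K L"
    and h: "h \<in> module_hom K (tensor K M N) L" "h' \<in> module_hom K (tensor K M N) L"
    and eq: "\<And>x y. x \<in> carrier M \<Longrightarrow> y \<in> carrier N \<Longrightarrow>
      h (pure_tensor K M N x y) = h' (pure_tensor K M N x y)"
    and X: "X \<in> carrier (tensor K M N)"
  shows "h X = h' X"
proof -
  interpret L: module K L by fact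
  have hom: "u \<in> hom (tensor_group K M N) (add_monoid L)" if "u \<in> module_hom K (tensor K M N) L" for u
    using module_hom_imp_hom [OF that] by (simp add: hom_def add_tensor)
  show ?thesis
    by (rule tensor_group_hom_eqI [where h = h and h' = h',
          OF mods(1,2) L.M.add.is_group hom [OF h(1)] hom [OF h(2)]])
      (use X in \<open>simp_all add: eq\<close>)
qed

text \<open>The universal property provides additivity only. Compatibility with scalars compares two
  group homomorphisms on pure tensors, where it is linearity of \<open>f\<close> in its first
  argument.\<close>

lemma
  assumes mods: "module K M" "module K N" "module K L" and f: "bilinear_map K M N L f"
  shows tensor_lift_linear: "tensor_lift (add_monoid L) f \<in> module_hom K (tensor K M N) L"
    and tensor_lift_pure: "\<And>x y. x \<in> carrier M \<Longrightarrow> y \<in> carrier N \<Longrightarrow>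
      tensor_lift (add_monoid L) f (pure_tensor K M N x y) = f x y"
proof -
  interpret M: module K M by fact
  interpret L: module K L by fact
  note lift = tensor_lift_universal [OF mods(1,2) L.M.a_comm_group bilinear_map_imp_balanced [OF f]]
  show pure: "tensor_lift (add_monoid L) f (pure_tensor K M N x y) = f x y"
    if "x \<in> carrier M" "y \<in> carrier N" for x y
    by (rule lift(2) [OF that])
  have smult_hom: "(\<lambda>z. a \<odot>\<^bsub>L\<^esub> z) \<in> hom (add_monoid L) (add_monoid L)" if "a \<in> carrier K" for a
    using that by (auto simp: hom_def L.smult_r_distr)
  show "tensor_lift (add_monoid L) f \<in> module_hom K (tensor K M N) L"
  proof (rule module_homI)
    fix X assume X: "X \<in> carrier (tensor K M N)"
    show "tensor_lift (add_monoid L) f X \<in> carrier L"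
      using hom_in_carrier [OF lift(1)] X by simp
    show "tensor_lift (add_monoid L) f (X \<oplus>\<^bsub>tensor K M N\<^esub> Y) =
        tensor_lift (add_monoid L) f X \<oplus>\<^bsub>L\<^esub> tensor_lift (add_monoid L) f Y"
      if "Y \<in> carrier (tensor K M N)" for Y
      using hom_mult [OF lift(1)] X that by (simp add: add_tensor)
    fix a assume a: "a \<in> carrier K"
    show "tensor_lift (add_monoid L) f (a \<odot>\<^bsub>tensor K M N\<^esub> X) = a \<odot>\<^bsub>L\<^esub> tensor_lift (add_monoid L) f X"
    proof (rule tensor_group_hom_eqI [OF mods(1,2) L.M.add.is_group])
      show "(\<lambda>X. tensor_lift (add_monoid L) f (a \<odot>\<^bsub>tensor K M N\<^esub> X)) \<in> hom (tensor_group K M N) (add_monoid L)"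
        using hom_compose [OF smult_tensor_hom [OF mods(1,2) a] lift(1)] by (simp add: comp_def)
      show "(\<lambda>X. a \<odot>\<^bsub>L\<^esub> tensor_lift (add_monoid L) f X) \<in> hom (tensor_group K M N) (add_monoid L)"
        using hom_compose [OF lift(1) smult_hom [OF a]] by (simp add: comp_def)
      show "X \<in> carrier (tensor_group K M N)" using X by simp
      show "tensor_lift (add_monoid L) f (a \<odot>\<^bsub>tensor K M N\<^esub> pure_tensor K M N x y) =
          a \<odot>\<^bsub>L\<^esub> tensor_lift (add_monoid L) f (pure_tensor K M N x y)"
        if "x \<in> carrier M" "y \<in> carrier N" for x y
        using that a module_hom_smult [OF bilinear_map_left [OF f that(2)] a that(1)]
        by (simp add: smult_pure_tensor [OF mods(1,2)] pure)
    qed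
  qed
qed

lemma tensor_lift_cong:
  assumes mods: "module K M" "module K N" "module K L"
    and f: "bilinear_map K M N L f" and g: "bilinear_map K M N L g"
    and eq: "\<And>x y. x \<in> carrier M \<Longrightarrow> y \<in> carrier N \<Longrightarrow> f x y = g x y"
    and X: "X \<in> carrier (tensor K M N)"
  shows "tensor_lift (add_monoid L) f X = tensor_lift (add_monoid L) g X"
  by (rule tensor_hom_eqI [OF mods tensor_lift_linear [OF mods f] tensor_lift_linear [OF mods g] _ X])
    (simp add: tensor_lift_pure [OF mods f] tensor_lift_pure [OF mods g] eq)

text \<open>The Sweedler rule that a linear map may be moved under the implicit sum: both sides are
  linear in \<open>X\<close> and agree on pure tensors.\<close>

lemma module_hom_tensor_lift:
  assumes mods: "module K M" "module K N" "module K L" "module K L'"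
    and f: "bilinear_map K M N L f" and g: "g \<in> module_hom K L L'"
    and X: "X \<in> carrier (tensor K M N)"
  shows "g (tensor_lift (add_monoid L) f X) = tensor_lift (add_monoid L') (\<lambda>x y. g (f x y)) X"
proof (rule tensor_hom_eqI [OF mods(1,2,4) _ _ _ X])
  note fg = bilinear_map_postcompose [OF f g]
  show "(\<lambda>X. g (tensor_lift (add_monoid L) f X)) \<in> module_hom K (tensor K M N) L'"
    by (rule module_hom_compose [OF tensor_lift_linear [OF mods(1-3) f] g])
  show "tensor_lift (add_monoid L') (\<lambda>x y. g (f x y)) \<in> module_hom K (tensor K M N) L'"
    by (rule tensor_lift_linear [OF mods(1,2,4) fg])
  show "g (tensor_lift (add_monoid L) f (pure_tensor K M N x y)) =
      tensor_lift (add_monoid L') (\<lambda>x y. g (f x y)) (pure_tensor K M N x y)"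
    if "x \<in> carrier M" "y \<in> carrier N" for x y
    using that by (simp add: tensor_lift_pure [OF mods(1-3) f] tensor_lift_pure [OF mods(1,2,4) fg])
qed

text \<open>Serves the nested lifts of \<open>tensor_assoc\<close>. For linearity in
  \<open>z\<close> the tensor \<open>X\<close> is fixed and need not be pure, so each law in
  \<open>z\<close> is read as an equality of two linear maps of \<open>X\<close>.\<close>

lemma tensor_lift_parametric:
  assumes mods: "module K A" "module K B" "module K C" "module K L"
    and F: "\<And>z. z \<in> carrier C \<Longrightarrow> bilinear_map K A B L (\<lambda>x y. F x y z)"
      "\<And>x y. x \<in> carrier A \<Longrightarrow> y \<in> carrier B \<Longrightarrow> (\<lambda>z. F x y z) \<in> module_hom K C L"
  shows "bilinear_map K (tensor K A B) C L (\<lambda>X z. tensor_lift (add_monoid L) (\<lambda>x y. F x y z) X)"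
proof (rule bilinear_mapI)
  interpret C: module K C by fact
  note lin = tensor_lift_linear [OF mods(1,2,4) F(1)]
    and pure = tensor_lift_pure [OF mods(1,2,4) F(1)]
    and eqI = tensor_hom_eqI [OF mods(1,2,4)]
  show "tensor_lift (add_monoid L) (\<lambda>x y. F x y z) \<in> module_hom K (tensor K A B) L"
    if "z \<in> carrier C" for z by (rule lin [OF that])
  fix X assume X: "X \<in> carrier (tensor K A B)"
  show "(\<lambda>z. tensor_lift (add_monoid L) (\<lambda>x y. F x y z) X) \<in> module_hom K C L"
  proof (rule module_homI)
    fix z assume z: "z \<in> carrier C"
    show "tensor_lift (add_monoid L) (\<lambda>x y. F x y z) X \<in> carrier L"
      by (rule module_hom_in_carrier [OF lin [OF z] X])
    show "tensor_lift (add_monoid L) (\<lambda>x y. F x y (z \<oplus>\<^bsub>C\<^esub> z')) X =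
        tensor_lift (add_monoid L) (\<lambda>x y. F x y z) X \<oplus>\<^bsub>L\<^esub> tensor_lift (add_monoid L) (\<lambda>x y. F x y z') X"
      if z': "z' \<in> carrier C" for z'
      by (rule eqI [OF lin module_hom_plus [OF mods(4) lin lin] _ X])
        (simp_all add: pure z z' module_hom_add [OF F(2)])
    show "tensor_lift (add_monoid L) (\<lambda>x y. F x y (a \<odot>\<^bsub>C\<^esub> z)) X =
        a \<odot>\<^bsub>L\<^esub> tensor_lift (add_monoid L) (\<lambda>x y. F x y z) X"
      if a: "a \<in> carrier K" for a
      by (rule eqI [OF lin module_hom_scale [OF mods(4) a lin] _ X])
        (simp_all add: pure z a module_hom_smult [OF F(2)])
  qed
qed

section \<open>Tensor products of linear maps, and the associator\<close>

lemma
  assumes mods: "module K M" "module K N" "module K M'" "module K N'"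
    and f: "f \<in> module_hom K M M'" and g: "g \<in> module_hom K N N'"
  shows tensor_map_linear: "tensor_map K M' N' f g \<in> module_hom K (tensor K M N) (tensor K M' N')"
    and tensor_map_pure: "\<And>x y. x \<in> carrier M \<Longrightarrow> y \<in> carrier N \<Longrightarrow>
      tensor_map K M' N' f g (pure_tensor K M N x y) = pure_tensor K M' N' (f x) (g y)"
proof -
  have t: "module K (tensor K M' N')" by (rule tensor_module [OF mods(3,4)])
  have b: "bilinear_map K M N (tensor K M' N') (\<lambda>x y. pure_tensor K M' N' (f x) (g y))"
    by (rule bilinear_map_compose [OF pure_tensor_bilinear [OF mods(3,4)] f g])
  show "tensor_map K M' N' f g \<in> module_hom K (tensor K M N) (tensor K M' N')"
    unfolding tensor_map_def by (rule tensor_lift_linear [OF mods(1,2) t b])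
  show "tensor_map K M' N' f g (pure_tensor K M N x y) = pure_tensor K M' N' (f x) (g y)"
    if "x \<in> carrier M" "y \<in> carrier N" for x y
    unfolding tensor_map_def by (rule tensor_lift_pure [OF mods(1,2) t b that])
qed

text \<open>The evaluation rule leaves \<open>X\<close> an arbitrary tensor, because in the
  coassociativity law its place is taken by \<Delta>(h), which is not pure in general.\<close>

lemma
  assumes mods: "module K A" "module K B" "module K C"
  shows tensor_assoc_linear: "tensor_assoc K A B C
      \<in> module_hom K (tensor K (tensor K A B) C) (tensor K A (tensor K B C))"
    and tensor_assoc_pure: "\<And>X z. X \<in> carrier (tensor K A B) \<Longrightarrow> z \<in> carrier C \<Longrightarrow>
      tensor_assoc K A B C (pure_tensor K (tensor K A B) C X z) =
      tensor_lift (add_monoid (tensor K A (tensor K B C)))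
        (\<lambda>x y. pure_tensor K A (tensor K B C) x (pure_tensor K B C y z)) X"
    and tensor_assoc_bilinear: "\<And>z. z \<in> carrier C \<Longrightarrow> bilinear_map K A B (tensor K A (tensor K B C))
      (\<lambda>x y. pure_tensor K A (tensor K B C) x (pure_tensor K B C y z))"
proof -
  note t = tensor_module
  note t3 = t [OF mods(1) t [OF mods(2,3)]] and t2 = t [OF mods(1,2)]
  note p1 = pure_tensor_bilinear [OF mods(1) t [OF mods(2,3)]]
    and p2 = pure_tensor_bilinear [OF mods(2,3)]
  show b: "bilinear_map K A B (tensor K A (tensor K B C))
      (\<lambda>x y. pure_tensor K A (tensor K B C) x (pure_tensor K B C y z))" if "z \<in> carrier C" for z
    by (rule bilinear_map_compose [OF p1 module_hom_id bilinear_map_left [OF p2 that]])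
  have c: "(\<lambda>z. pure_tensor K A (tensor K B C) x (pure_tensor K B C y z))
      \<in> module_hom K C (tensor K A (tensor K B C))" if "x \<in> carrier A" "y \<in> carrier B" for x y
    by (rule module_hom_compose [OF bilinear_map_right [OF p2 that(2)] bilinear_map_right [OF p1 that(1)]])
  note bb = tensor_lift_parametric [OF mods t3 b c]
  show "tensor_assoc K A B C
      \<in> module_hom K (tensor K (tensor K A B) C) (tensor K A (tensor K B C))"
    unfolding tensor_assoc_def by (rule tensor_lift_linear [OF t2 mods(3) t3 bb])
  show "tensor_assoc K A B C (pure_tensor K (tensor K A B) C X z) =
      tensor_lift (add_monoid (tensor K A (tensor K B C)))
        (\<lambda>x y. pure_tensor K A (tensor K B C) x (pure_tensor K B C y z)) X"
    if "X \<in> carrier (tensor K A B)" "z \<in> carrier C" for X z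
    unfolding tensor_assoc_def by (rule tensor_lift_pure [OF t2 mods(3) t3 bb that])
qed

text \<open>
  The two target groups coincide, but their records have different extension fields, so the lifts
  are not syntactically equal.
\<close>

lemma tensor_lift_ground:
  assumes mods: "module K M" "module K N" and K: "module K (ground K)"
    and f: "bilinear_map K M N (ground K) f" and X: "X \<in> carrier (tensor K M N)"
  shows "tensor_lift (add_monoid K) f X = tensor_lift (add_monoid (ground K)) f X"
proof -
  interpret M: module K M by fact
  interpret K: module K "ground K" by fact
  have b: "balanced K M N (add_monoid (ground K)) f"
    by (rule bilinear_map_imp_balanced [OF f])
  then have b': "balanced K M N (add_monoid K) f"
    by (simp add: balanced_def ground_def)
  have hom: "hom (tensor_group K M N) (add_monoid (ground K)) = hom (tensor_group K M N) (add_monoid K)"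
    by (simp add: hom_def ground_def)
  note g = tensor_lift_universal [OF mods K.M.a_comm_group b, unfolded hom]
    and k = tensor_lift_universal [OF mods M.R.a_comm_group b']
  show ?thesis
    by (rule tensor_group_hom_eqI [OF mods M.R.add.is_group k(1) g(1)])
      (use X in \<open>simp_all add: g(2) k(2)\<close>)
qed

lemma tensor_map_cong:
  assumes mods: "module K M" "module K N" "module K M'" "module K N'"
    and f: "f \<in> module_hom K M M'" and g: "g \<in> module_hom K N N'"
    and eq: "\<And>x. x \<in> carrier M \<Longrightarrow> f' x = f x" "\<And>y. y \<in> carrier N \<Longrightarrow> g' y = g y"
    and X: "X \<in> carrier (tensor K M N)"
  shows "tensor_map K M' N' f' g' X = tensor_map K M' N' f g X"
proof -
  have f': "f' \<in> module_hom K M M'" and g': "g' \<in> module_hom K N N'"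
    using module_hom_cong [OF mods(1) f] module_hom_cong [OF mods(2) g] eq by blast+
  show ?thesis
    by (rule tensor_hom_eqI [where h = "tensor_map K M' N' f' g'" and h' = "tensor_map K M' N' f g",
          OF mods(1,2) tensor_module [OF mods(3,4)]
          tensor_map_linear [OF mods f' g'] tensor_map_linear [OF mods f g] _ X])
      (simp add: tensor_map_pure [OF mods f' g'] tensor_map_pure [OF mods f g] eq)
qed


section \<open>Linear functionals separate points\<close>

text \<open>A subspace \<open>W\<close> maximal among those avoiding \<open>v\<close> is a
  complement of the line K v. The functional is the negative of the \<open>v\<close>-coordinate
  along \<open>W\<close>: its value at \<open>x\<close> is the unique scalar c with x + c v in
  \<open>W\<close>.\<close>

lemma (in vectorspace) functional_separates:
  assumes v: "v \<in> carrier V" "v \<noteq> \<zero>\<^bsub>V\<^esub>"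
  shows "\<exists>f \<in> module_hom K V (ground K). f v \<noteq> \<zero>\<^bsub>K\<^esub>"
proof -
  \<comment> \<open>\<open>S\<close> singles out the subspaces. Two vectors in the union of a chain
    lie in a common member, so the union is again a subspace.\<close>
  define S where "S W \<longleftrightarrow> W \<subseteq> carrier V \<and> \<zero>\<^bsub>V\<^esub> \<in> W \<and> (\<forall>x\<in>W. \<forall>y\<in>W. x \<oplus>\<^bsub>V\<^esub> y \<in> W) \<and>
      (\<forall>a\<in>carrier K. \<forall>x\<in>W. a \<odot>\<^bsub>V\<^esub> x \<in> W)" for W
  have "\<exists>W \<in> {W. S W \<and> v \<notin> W}. \<forall>X \<in> {W. S W \<and> v \<notin> W}. W \<subseteq> X \<longrightarrow> X = W"
  proof (rule subset_Zorn_nonempty)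
    have "S {\<zero>\<^bsub>V\<^esub>}" by (simp add: S_def)
    with v show "{W. S W \<and> v \<notin> W} \<noteq> {}" by blast
    fix C assume C: "C \<noteq> {}" "subset.chain {W. S W \<and> v \<notin> W} C"
    then have SC: "S W" "v \<notin> W" if "W \<in> C" for W
      using that by (auto simp: subset.chain_def)
    have "x \<oplus>\<^bsub>V\<^esub> y \<in> \<Union>C" if "x \<in> \<Union>C" "y \<in> \<Union>C" for x y
    proof -
      from that obtain X Y where XY: "X \<in> C" "Y \<in> C" "x \<in> X" "y \<in> Y" by blast
      with C have "X \<subseteq> Y \<or> Y \<subseteq> X" by (auto simp: subset_chain_def)
      then obtain Z where "Z \<in> C" "x \<in> Z" "y \<in> Z" using XY by blast
      then show ?thesis using SC(1) unfolding S_def by blast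
    qed
    moreover have "\<Union>C \<subseteq> carrier V" "\<zero>\<^bsub>V\<^esub> \<in> \<Union>C"
      "\<forall>a\<in>carrier K. \<forall>x\<in>\<Union>C. a \<odot>\<^bsub>V\<^esub> x \<in> \<Union>C"
      using C(1) SC(1) unfolding S_def by blast+
    ultimately show "\<Union>C \<in> {W. S W \<and> v \<notin> W}"
      using SC(2) unfolding S_def by blast
  qed
  then obtain W where W: "S W" "v \<notin> W"
    and max: "\<And>X. S X \<Longrightarrow> v \<notin> X \<Longrightarrow> W \<subseteq> X \<Longrightarrow> X = W"
    by blast
  from W(1) have WV: "\<And>x. x \<in> W \<Longrightarrow> x \<in> carrier V" and W0: "\<zero>\<^bsub>V\<^esub> \<in> W"
    and Wadd: "\<And>x y. x \<in> W \<Longrightarrow> y \<in> W \<Longrightarrow> x \<oplus>\<^bsub>V\<^esub> y \<in> W"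
    and Wsmult: "\<And>a x. a \<in> carrier K \<Longrightarrow> x \<in> W \<Longrightarrow> a \<odot>\<^bsub>V\<^esub> x \<in> W"
    by (auto simp: S_def)
  \<comment> \<open>Two distinct scalars would put (c - d) v into \<open>W\<close>; dividing by c -
    d would put \<open>v\<close> there as well.\<close>
  have unique: "c = d"
    if c: "c \<in> carrier K" "x \<oplus>\<^bsub>V\<^esub> c \<odot>\<^bsub>V\<^esub> v \<in> W" and d: "d \<in> carrier K" "x \<oplus>\<^bsub>V\<^esub> d \<odot>\<^bsub>V\<^esub> v \<in> W"
      and x: "x \<in> carrier V" for c d x
  proof (rule ccontr)
    assume ne: "c \<noteq> d"
    let ?e = "c \<ominus>\<^bsub>K\<^esub> d"
    have e: "?e \<in> carrier K" "?e \<noteq> \<zero>\<^bsub>K\<^esub>"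
      using c d ne by auto
    have "(x \<oplus>\<^bsub>V\<^esub> c \<odot>\<^bsub>V\<^esub> v) \<oplus>\<^bsub>V\<^esub> (\<ominus>\<^bsub>K\<^esub> \<one>\<^bsub>K\<^esub>) \<odot>\<^bsub>V\<^esub> (x \<oplus>\<^bsub>V\<^esub> d \<odot>\<^bsub>V\<^esub> v) \<in> W"
      by (rule Wadd [OF c(2) Wsmult [OF _ d(2)]]) simp
    also have "(x \<oplus>\<^bsub>V\<^esub> c \<odot>\<^bsub>V\<^esub> v) \<oplus>\<^bsub>V\<^esub> (\<ominus>\<^bsub>K\<^esub> \<one>\<^bsub>K\<^esub>) \<odot>\<^bsub>V\<^esub> (x \<oplus>\<^bsub>V\<^esub> d \<odot>\<^bsub>V\<^esub> v) =
        (x \<oplus>\<^bsub>V\<^esub> c \<odot>\<^bsub>V\<^esub> v) \<ominus>\<^bsub>V\<^esub> (x \<oplus>\<^bsub>V\<^esub> d \<odot>\<^bsub>V\<^esub> v)"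
      using c d x v by (simp add: smult_l_minus M.minus_eq)
    also have "\<dots> = c \<odot>\<^bsub>V\<^esub> v \<ominus>\<^bsub>V\<^esub> d \<odot>\<^bsub>V\<^esub> v"
      using c d x v by (simp add: M.minus_eq M.minus_add M.a_ac M.r_neg1 M.r_neg2)
    also have "\<dots> = ?e \<odot>\<^bsub>V\<^esub> v"
      using c d v by (simp add: R.minus_eq M.minus_eq smult_l_distr smult_l_minus)
    finally have ev: "?e \<odot>\<^bsub>V\<^esub> v \<in> W" .
    have "inv\<^bsub>K\<^esub> ?e \<odot>\<^bsub>V\<^esub> (?e \<odot>\<^bsub>V\<^esub> v) \<in> W"
      using e by (intro Wsmult [OF _ ev]) (auto simp: field_Units)
    then show False
      using e v W(2) by (simp add: field_Units flip: smult_assoc1)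
  qed
  have ex: "\<exists>c \<in> carrier K. x \<oplus>\<^bsub>V\<^esub> c \<odot>\<^bsub>V\<^esub> v \<in> W" if x: "x \<in> carrier V" for x
  proof (cases "x \<in> W")
    case True
    then show ?thesis using v x by (intro bexI [of _ "\<zero>\<^bsub>K\<^esub>"]) auto
  next
    case False
    \<comment> \<open>The span of \<open>x\<close> and \<open>W\<close> is strictly larger than
      \<open>W\<close>, so by maximality it contains v = b x + w. Here b is nonzero because
      \<open>v\<close> is not in \<open>W\<close>, and the required scalar is minus the inverse of
      b.\<close>
    define X where "X = {b \<odot>\<^bsub>V\<^esub> x \<oplus>\<^bsub>V\<^esub> w | b w. b \<in> carrier K \<and> w \<in> W}"
    have "S X"
      unfolding S_def
    proof (intro conjI ballI)
      show "X \<subseteq> carrier V" using x WV by (auto simp: X_def)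
      show "\<zero>\<^bsub>V\<^esub> \<in> X"
        unfolding X_def using x W0 by (intro CollectI exI [of _ "\<zero>\<^bsub>K\<^esub>"] exI [of _ "\<zero>\<^bsub>V\<^esub>"]) auto
    next
      fix y z assume "y \<in> X" "z \<in> X"
      then obtain b w c u where y: "y = b \<odot>\<^bsub>V\<^esub> x \<oplus>\<^bsub>V\<^esub> w" "b \<in> carrier K" "w \<in> W"
        and z: "z = c \<odot>\<^bsub>V\<^esub> x \<oplus>\<^bsub>V\<^esub> u" "c \<in> carrier K" "u \<in> W"
        by (auto simp: X_def)
      then have "y \<oplus>\<^bsub>V\<^esub> z = (b \<oplus>\<^bsub>K\<^esub> c) \<odot>\<^bsub>V\<^esub> x \<oplus>\<^bsub>V\<^esub> (w \<oplus>\<^bsub>V\<^esub> u)"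
        using x WV by (simp add: smult_l_distr M.a_ac)
      then show "y \<oplus>\<^bsub>V\<^esub> z \<in> X" unfolding X_def using y z Wadd by blast
    next
      fix a y assume a: "a \<in> carrier K" and "y \<in> X"
      then obtain b w where y: "y = b \<odot>\<^bsub>V\<^esub> x \<oplus>\<^bsub>V\<^esub> w" "b \<in> carrier K" "w \<in> W"
        by (auto simp: X_def)
      then have "a \<odot>\<^bsub>V\<^esub> y = (a \<otimes>\<^bsub>K\<^esub> b) \<odot>\<^bsub>V\<^esub> x \<oplus>\<^bsub>V\<^esub> a \<odot>\<^bsub>V\<^esub> w"
        using a x WV by (simp add: smult_r_distr smult_assoc1)
      then show "a \<odot>\<^bsub>V\<^esub> y \<in> X" unfolding X_def using a y Wsmult by blast
    qed
    moreover have "W \<subseteq> X"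
    proof
      fix w assume w: "w \<in> W"
      then have "w = \<zero>\<^bsub>K\<^esub> \<odot>\<^bsub>V\<^esub> x \<oplus>\<^bsub>V\<^esub> w" using x WV by simp
      then show "w \<in> X" unfolding X_def using w by blast
    qed
    moreover have "x \<in> X"
    proof -
      have "x = \<one>\<^bsub>K\<^esub> \<odot>\<^bsub>V\<^esub> x \<oplus>\<^bsub>V\<^esub> \<zero>\<^bsub>V\<^esub>" using x by simp
      then show ?thesis unfolding X_def using W0 by blast
    qed
    ultimately have "v \<in> X" using max [of X] False by blast
    then obtain b w where b: "b \<in> carrier K" "w \<in> W" and vb: "v = b \<odot>\<^bsub>V\<^esub> x \<oplus>\<^bsub>V\<^esub> w"
      by (auto simp: X_def)
    have "b \<noteq> \<zero>\<^bsub>K\<^esub>" using vb W(2) b x WV by auto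
    then have bi: "inv\<^bsub>K\<^esub> b \<in> carrier K" "inv\<^bsub>K\<^esub> b \<otimes>\<^bsub>K\<^esub> b = \<one>\<^bsub>K\<^esub>"
      using b by (auto simp: field_Units)
    have "x \<oplus>\<^bsub>V\<^esub> (\<ominus>\<^bsub>K\<^esub> (inv\<^bsub>K\<^esub> b)) \<odot>\<^bsub>V\<^esub> v = (\<ominus>\<^bsub>K\<^esub> (inv\<^bsub>K\<^esub> b)) \<odot>\<^bsub>V\<^esub> w"
    proof -
      have "(\<ominus>\<^bsub>K\<^esub> (inv\<^bsub>K\<^esub> b)) \<odot>\<^bsub>V\<^esub> v = (\<ominus>\<^bsub>K\<^esub> (inv\<^bsub>K\<^esub> b)) \<odot>\<^bsub>V\<^esub> (b \<odot>\<^bsub>V\<^esub> x) \<oplus>\<^bsub>V\<^esub> (\<ominus>\<^bsub>K\<^esub> (inv\<^bsub>K\<^esub> b)) \<odot>\<^bsub>V\<^esub> w"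
        unfolding vb using b bi x WV by (simp add: smult_r_distr)
      also have "(\<ominus>\<^bsub>K\<^esub> (inv\<^bsub>K\<^esub> b)) \<odot>\<^bsub>V\<^esub> (b \<odot>\<^bsub>V\<^esub> x) = \<ominus>\<^bsub>V\<^esub> x"
        using b bi x by (simp add: smult_l_minus R.l_minus flip: smult_assoc1)
      finally show ?thesis
        using b bi x WV by (simp add: M.r_neg2)
    qed
    then show ?thesis using b bi Wsmult by (intro bexI [of _ "\<ominus>\<^bsub>K\<^esub> (inv\<^bsub>K\<^esub> b)"]) auto
  qed
  define f where "f x = (THE c. c \<in> carrier K \<and> x \<oplus>\<^bsub>V\<^esub> c \<odot>\<^bsub>V\<^esub> v \<in> W)" for x
  have f: "f x = c" if "x \<in> carrier V" "c \<in> carrier K" "x \<oplus>\<^bsub>V\<^esub> c \<odot>\<^bsub>V\<^esub> v \<in> W" for x c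
    unfolding f_def using that unique by (intro the_equality) blast+
  have fK: "f x \<in> carrier K" and fW: "x \<oplus>\<^bsub>V\<^esub> f x \<odot>\<^bsub>V\<^esub> v \<in> W" if x: "x \<in> carrier V" for x
    using ex [OF x] f [OF x] by auto
  have "f \<in> module_hom K V (ground K)"
  proof (rule module_homI)
    fix x assume x: "x \<in> carrier V"
    show "f x \<in> carrier (ground K)" using fK x by (simp add: ground_def)
    show "f (x \<oplus>\<^bsub>V\<^esub> y) = f x \<oplus>\<^bsub>ground K\<^esub> f y" if y: "y \<in> carrier V" for y
    proof -
      have "(x \<oplus>\<^bsub>V\<^esub> y) \<oplus>\<^bsub>V\<^esub> (f x \<oplus>\<^bsub>K\<^esub> f y) \<odot>\<^bsub>V\<^esub> v = (x \<oplus>\<^bsub>V\<^esub> f x \<odot>\<^bsub>V\<^esub> v) \<oplus>\<^bsub>V\<^esub> (y \<oplus>\<^bsub>V\<^esub> f y \<odot>\<^bsub>V\<^esub> v)"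
        using x y v fK by (simp add: smult_l_distr M.a_ac)
      then have "f (x \<oplus>\<^bsub>V\<^esub> y) = f x \<oplus>\<^bsub>K\<^esub> f y"
        using x y fK fW Wadd by (intro f) simp_all
      then show ?thesis by (simp add: ground_def)
    qed
    show "f (a \<odot>\<^bsub>V\<^esub> x) = a \<odot>\<^bsub>ground K\<^esub> f x" if a: "a \<in> carrier K" for a
    proof -
      have "a \<odot>\<^bsub>V\<^esub> x \<oplus>\<^bsub>V\<^esub> (a \<otimes>\<^bsub>K\<^esub> f x) \<odot>\<^bsub>V\<^esub> v = a \<odot>\<^bsub>V\<^esub> (x \<oplus>\<^bsub>V\<^esub> f x \<odot>\<^bsub>V\<^esub> v)"
        using x a v fK by (simp add: smult_r_distr smult_assoc1)
      then have "f (a \<odot>\<^bsub>V\<^esub> x) = a \<otimes>\<^bsub>K\<^esub> f x"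
        using x a fK fW Wsmult by (intro f) simp_all
      then show ?thesis by (simp add: ground_def)
    qed
  qed
  \<comment> \<open>A zero value would place \<open>v\<close> itself in \<open>W\<close>.\<close>
  moreover have "f v \<noteq> \<zero>\<^bsub>K\<^esub>"
    using fW [OF v(1)] W(2) v by auto
  ultimately show ?thesis by blast
qed

lemma (in vectorspace) eq_if_functionals_eq:
  assumes x: "x \<in> carrier V" and y: "y \<in> carrier V"
    and eq: "\<And>f. f \<in> dual K V \<Longrightarrow> f x = f y"
  shows "x = y"
proof (rule ccontr)
  assume "x \<noteq> y"
  then have d: "x \<ominus>\<^bsub>V\<^esub> y \<in> carrier V" "x \<ominus>\<^bsub>V\<^esub> y \<noteq> \<zero>\<^bsub>V\<^esub>"
    using x y by auto
  then obtain f where f: "f \<in> module_hom K V (ground K)" and ne: "f (x \<ominus>\<^bsub>V\<^esub> y) \<noteq> \<zero>\<^bsub>K\<^esub>"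
    using functional_separates by blast
  have "f (x \<ominus>\<^bsub>V\<^esub> y) \<in> carrier K" "f y \<in> carrier K"
    using module_hom_in_carrier [OF f] d y by (auto simp: ground_def)
  \<comment> \<open>Additivity alone suffices: x is (x - y) + y, and \<open>f\<close> agrees on x
    and y.\<close>
  moreover have "f (x \<ominus>\<^bsub>V\<^esub> y) \<oplus>\<^bsub>K\<^esub> f y = f y"
  proof -
    have "(x \<ominus>\<^bsub>V\<^esub> y) \<oplus>\<^bsub>V\<^esub> y = x" using x y by (simp add: M.minus_eq M.a_assoc M.l_neg)
    then show ?thesis
      using module_hom_add [OF f d(1) y] eq [of f] f by (simp add: ground_def dual_def)
  qed
  ultimately show False using ne by (metis R.add.r_cancel_one')
qed


section \<open>The action of a functional on a comodule\<close>

text \<open>The right action of the convolution algebra H* on a left comodule. For the cointegral it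
  is T, and on \<open>H\<close> with coaction \<open>\<Delta>\<close> it is P, so one construction
  covers both maps.\<close>

definition functional_action ::
  "('k, 'a, 'y) module_scheme \<Rightarrow> ('a \<Rightarrow> ('h \<times> 'a \<Rightarrow>\<^sub>0 int) set) \<Rightarrow> ('h \<Rightarrow> 'k) \<Rightarrow> 'a \<Rightarrow> 'a" where
  "functional_action M \<rho> l m = tensor_lift (add_monoid M) (\<lambda>h n. l h \<odot>\<^bsub>M\<^esub> n) (\<rho> m)"

lemma (in cring) ground_module: "module R (ground R)"
  by (rule moduleI)
    (auto intro!: cring_axioms abelian_groupI bexI [of _ "\<ominus> x" for x]
      simp: ground_def a_ac l_distr r_distr m_assoc r_neg)

text \<open>Lets every statement about T be reused for P, and yields the coalgebra half of the
  theorem.\<close>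

lemma (in coalgebra) left_comodule_self: "left_comodule K C \<Delta> \<epsilon> C \<Delta>"
  by unfold_locales (fact comult_linear coassoc counit_left)+

context left_comodule
begin

lemma module_H: "module K H" and module_M: "module K M"
  by unfold_locales

lemmas module_HM = tensor_module [OF module_H module_M]

lemma comult_in_tensor: "h \<in> carrier H \<Longrightarrow> \<Delta> h \<in> carrier (tensor K H H)"
  by (rule module_hom_in_carrier [OF H.comult_linear])

lemma coaction_in_tensor: "m \<in> carrier M \<Longrightarrow> \<rho> m \<in> carrier (tensor K H M)"
  by (rule module_hom_in_carrier [OF coaction_linear])

lemma functional_smult_bilinear:
  assumes "l \<in> dual K H" "module K N"
  shows "bilinear_map K H N N (\<lambda>h n. l h \<odot>\<^bsub>N\<^esub> n)"
  using assms by (intro bilinear_map_smult module_H) (simp_all add: dual_def)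

lemma functional_action_linear:
  assumes "l \<in> dual K H"
  shows "functional_action M \<rho> l \<in> module_hom K M M"
  unfolding functional_action_def
  by (rule module_hom_compose [OF coaction_linear
        tensor_lift_linear [OF module_H module_M module_M functional_smult_bilinear [OF assms module_M]]])

text \<open>Coassociativity, contracted with the functional in the first tensor factor.\<close>

lemma coaction_functional_action:
  assumes l: "l \<in> dual K H" and P: "functional_action H \<Delta> l \<in> module_hom K H H"
    and m: "m \<in> carrier M"
  shows "\<rho> (functional_action M \<rho> l m) = tensor_map K H M (functional_action H \<Delta> l) id (\<rho> m)"
proof -
  let ?P = "functional_action H \<Delta> l" and ?HM = "tensor K H M" and ?HH = "tensor K H H"
  \<comment> \<open>\<open>?\<Phi>\<close> applies the functional to the first factor of H \<otimes>
    (H \<otimes> M), \<open>?L\<close> to that of H \<otimes> M.\<close>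
  let ?\<Phi> = "tensor_lift (add_monoid ?HM) (\<lambda>x Y. l x \<odot>\<^bsub>?HM\<^esub> Y)"
  let ?L = "tensor_lift (add_monoid M) (\<lambda>h n. l h \<odot>\<^bsub>M\<^esub> n)"
  note H = module_H and M = module_M and HM = module_HM and HH = tensor_module [OF module_H module_H]
  note \<Phi>b = functional_smult_bilinear [OF l HM] and Lb = functional_smult_bilinear [OF l M]
    and Pb = functional_smult_bilinear [OF l H]
  note \<Phi> = tensor_lift_linear [OF H HM HM \<Phi>b] and \<Phi>p = tensor_lift_pure [OF H HM HM \<Phi>b]
  note L = tensor_lift_linear [OF H M M Lb] and Lp = tensor_lift_pure [OF H M M Lb]
  have idM: "id \<in> module_hom K M M" and idH: "id \<in> module_hom K H H"
    by (simp_all add: module_hom_id id_def)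
  note a = tensor_assoc_linear [OF H H M] and ap = tensor_assoc_pure [OF H H M]
    and ab = tensor_assoc_bilinear [OF H H M]
  note D = tensor_map_linear [OF H M HH M H.comult_linear idM]
    and Dp = tensor_map_pure [OF H M HH M H.comult_linear idM]
  note R = tensor_map_linear [OF H M H HM idH coaction_linear]
    and Rp = tensor_map_pure [OF H M H HM idH coaction_linear]
  note Q = tensor_map_linear [OF H M H M P idM] and Qp = tensor_map_pure [OF H M H M P idM]
  note X = coaction_in_tensor [OF m]
  \<comment> \<open>On h \<otimes> n both sides equal \<lambda>(h) \<rho>(n), by linearity of
    \<rho>.\<close>
  have "\<rho> (?L (\<rho> m)) = ?\<Phi> (tensor_map K H ?HM id \<rho> (\<rho> m))"
  proof (rule tensor_hom_eqI [OF H M HM module_hom_compose [OF L coaction_linear]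
        module_hom_compose [OF R \<Phi>] _ X])
    fix h n assume h: "h \<in> carrier H" and n: "n \<in> carrier M"
    have "l h \<in> carrier K"
      using l h by (auto simp: dual_def module_hom_def ground_def)
    then show "\<rho> (?L (pure_tensor K H M h n)) = ?\<Phi> (tensor_map K H ?HM id \<rho> (pure_tensor K H M h n))"
      using h n coaction_in_tensor [OF n]
      by (simp add: Lp Rp \<Phi>p module_hom_smult [OF coaction_linear] del: carrier_tensor)
  qed
  also have "\<dots> = ?\<Phi> (tensor_assoc K H H M (tensor_map K ?HH M \<Delta> id (\<rho> m)))"
    by (simp add: coaction_coassoc [OF m])
  also have "\<dots> = tensor_map K H M ?P id (\<rho> m)"
  proof (rule tensor_hom_eqI [where h = "\<lambda>X. ?\<Phi> (tensor_assoc K H H M (tensor_map K ?HH M \<Delta> id X))",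
        OF H M HM module_hom_compose [OF module_hom_compose [OF D a] \<Phi>] Q _ X])
    fix h n assume h: "h \<in> carrier H" and n: "n \<in> carrier M"
    note Dh = comult_in_tensor [OF h]
    have pn: "(\<lambda>y. pure_tensor K H M y n) \<in> module_hom K H ?HM"
      by (rule bilinear_map_left [OF pure_tensor_bilinear [OF H M] n])
    have "?\<Phi> (tensor_assoc K H H M (tensor_map K ?HH M \<Delta> id (pure_tensor K H M h n))) =
        ?\<Phi> (tensor_lift (add_monoid (tensor K H ?HM))
          (\<lambda>x y. pure_tensor K H ?HM x (pure_tensor K H M y n)) (\<Delta> h))"
      using h n Dh by (simp add: Dp ap del: carrier_tensor)
    also have "\<dots> = tensor_lift (add_monoid ?HM)
          (\<lambda>x y. ?\<Phi> (pure_tensor K H ?HM x (pure_tensor K H M y n))) (\<Delta> h)"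
      by (rule module_hom_tensor_lift [OF H H tensor_module [OF H HM] HM ab [OF n] \<Phi> Dh])
    also have "\<dots> = tensor_lift (add_monoid ?HM) (\<lambda>x y. pure_tensor K H M (l x \<odot>\<^bsub>H\<^esub> y) n) (\<Delta> h)"
    proof (rule tensor_lift_cong [OF H H HM bilinear_map_postcompose [OF ab [OF n] \<Phi>]
          bilinear_map_postcompose [OF Pb pn] _ Dh])
      fix x y assume x: "x \<in> carrier H" and y: "y \<in> carrier H"
      have "l x \<in> carrier K"
        using l x by (auto simp: dual_def module_hom_def ground_def)
      then show "?\<Phi> (pure_tensor K H ?HM x (pure_tensor K H M y n)) = pure_tensor K H M (l x \<odot>\<^bsub>H\<^esub> y) n"
        using x y n by (simp add: \<Phi>p pure_tensor_closed smult_pure_tensor [OF H M] del: carrier_tensor)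
    qed
    also have "\<dots> = pure_tensor K H M (?P h) n"
      unfolding functional_action_def
      by (rule module_hom_tensor_lift [OF H H H HM Pb pn Dh, symmetric])
    finally show "?\<Phi> (tensor_assoc K H H M (tensor_map K ?HH M \<Delta> id (pure_tensor K H M h n))) =
        tensor_map K H M ?P id (pure_tensor K H M h n)"
      using h n by (simp add: Qp)
  qed
  finally show ?thesis by (simp add: functional_action_def)
qed

section \<open>The cointegral identity inside \<open>H\<close> and its contraction\<close>

lemma functional_in_carrier: "l \<in> dual K H \<Longrightarrow> h \<in> carrier H \<Longrightarrow> l h \<in> carrier K"
  by (auto simp: dual_def module_hom_def ground_def)

lemma coalgebra_functional_action_linear:
  "l \<in> dual K H \<Longrightarrow> functional_action H \<Delta> l \<in> module_hom K H H"
  by (rule left_comodule.functional_action_linear [OF H.left_comodule_self])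

text \<open>
  The cointegral identity \<open>f \<lambda> = f(1) \<lambda>\<close>, known for all functionals \<open>f\<close>, is lifted to
  \<open>h\<^sub>1 \<lambda>(h\<^sub>2) = \<lambda>(h) 1\<close> in \<open>H\<close> because functionals separate points.
\<close>

lemma left_cointegral_contraction:
  assumes l: "left_cointegral K H \<Delta> l" and one: "\<one>\<^bsub>H\<^esub> \<in> carrier H" and h: "h \<in> carrier H"
  shows "tensor_lift (add_monoid H) (\<lambda>x y. l y \<odot>\<^bsub>H\<^esub> x) (\<Delta> h) = l h \<odot>\<^bsub>H\<^esub> \<one>\<^bsub>H\<^esub>"
proof (rule H.eq_if_functionals_eq)
  note H = module_H and K = H.R.ground_module and Dh = comult_in_tensor [OF h]
  have ld: "l \<in> dual K H" using l by (simp add: left_cointegral_def)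
  have b: "bilinear_map K H H H (\<lambda>x y. l y \<odot>\<^bsub>H\<^esub> x)"
    by (rule bilinear_map_flip [OF functional_smult_bilinear [OF ld H]])
  show "tensor_lift (add_monoid H) (\<lambda>x y. l y \<odot>\<^bsub>H\<^esub> x) (\<Delta> h) \<in> carrier H"
    by (rule module_hom_in_carrier [OF tensor_lift_linear [OF H H H b] Dh])
  show "l h \<odot>\<^bsub>H\<^esub> \<one>\<^bsub>H\<^esub> \<in> carrier H"
    using functional_in_carrier [OF ld h] one by simp
  fix f assume f: "f \<in> dual K H"
  then have fh: "f \<in> module_hom K H (ground K)" by (simp add: dual_def)
  have f_smult: "f (a \<odot>\<^bsub>H\<^esub> x) = f x \<otimes>\<^bsub>K\<^esub> a" if "a \<in> carrier K" "x \<in> carrier H" for a x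
    using module_hom_smult [OF fh that] functional_in_carrier [OF f that(2)] that
    by (simp add: ground_def H.R.m_comm)
  note fb = bilinear_map_postcompose [OF b fh]
  have conv: "bilinear_map K H H (ground K) (\<lambda>x y. f x \<otimes>\<^bsub>K\<^esub> l y)"
    by (rule bilinear_map_cong [OF H H fb]) (simp add: f_smult functional_in_carrier [OF ld])
  have "f (tensor_lift (add_monoid H) (\<lambda>x y. l y \<odot>\<^bsub>H\<^esub> x) (\<Delta> h)) =
      tensor_lift (add_monoid (ground K)) (\<lambda>x y. f (l y \<odot>\<^bsub>H\<^esub> x)) (\<Delta> h)"
    by (rule module_hom_tensor_lift [OF H H H K b fh Dh])
  also have "\<dots> = tensor_lift (add_monoid (ground K)) (\<lambda>x y. f x \<otimes>\<^bsub>K\<^esub> l y) (\<Delta> h)"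
    by (rule tensor_lift_cong [OF H H K fb conv _ Dh]) (simp add: f_smult functional_in_carrier [OF ld])
  \<comment> \<open>\<open>convolution\<close> lifts into the additive group of \<open>K\<close>,
    while the linear theory lifts into that of \<open>ground K\<close>.\<close>
  also have "\<dots> = convolution K \<Delta> f l h"
    unfolding convolution_def by (rule tensor_lift_ground [OF H H K conv Dh, symmetric])
  also have "\<dots> = f \<one>\<^bsub>H\<^esub> \<otimes>\<^bsub>K\<^esub> l h"
    using l f h by (simp add: left_cointegral_def dual_counit_def)
  also have "\<dots> = f (l h \<odot>\<^bsub>H\<^esub> \<one>\<^bsub>H\<^esub>)"
    using one by (simp add: f_smult functional_in_carrier [OF ld h])
  finally show "f (tensor_lift (add_monoid H) (\<lambda>x y. l y \<odot>\<^bsub>H\<^esub> x) (\<Delta> h)) = f (l h \<odot>\<^bsub>H\<^esub> \<one>\<^bsub>H\<^esub>)" .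
qed

lemma functional_of_functional_action:
  assumes l: "l \<in> dual K H" and h: "h \<in> carrier H"
  shows "l (functional_action H \<Delta> l h) = convolution K \<Delta> l l h"
proof -
  note H = module_H and K = H.R.ground_module and Dh = comult_in_tensor [OF h]
  have lh: "l \<in> module_hom K H (ground K)" using l by (simp add: dual_def)
  note b = functional_smult_bilinear [OF l H]
  note lb = bilinear_map_postcompose [OF b lh]
  have l_smult: "l (l x \<odot>\<^bsub>H\<^esub> y) = l x \<otimes>\<^bsub>K\<^esub> l y" if "x \<in> carrier H" "y \<in> carrier H" for x y
    using module_hom_smult [OF lh functional_in_carrier [OF l that(1)] that(2)]
    by (simp add: ground_def)
  have conv: "bilinear_map K H H (ground K) (\<lambda>x y. l x \<otimes>\<^bsub>K\<^esub> l y)"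
    by (rule bilinear_map_cong [OF H H lb]) (simp add: l_smult)
  have "l (functional_action H \<Delta> l h) = tensor_lift (add_monoid (ground K)) (\<lambda>x y. l (l x \<odot>\<^bsub>H\<^esub> y)) (\<Delta> h)"
    unfolding functional_action_def by (rule module_hom_tensor_lift [OF H H H K b lh Dh])
  also have "\<dots> = tensor_lift (add_monoid (ground K)) (\<lambda>x y. l x \<otimes>\<^bsub>K\<^esub> l y) (\<Delta> h)"
    by (rule tensor_lift_cong [OF H H K lb conv _ Dh]) (simp add: l_smult)
  also have "\<dots> = convolution K \<Delta> l l h"
    unfolding convolution_def by (rule tensor_lift_ground [OF H H K conv Dh, symmetric])
  finally show ?thesis .
qed

text \<open>Coassociativity, contracted with the cointegral in the second tensor factor.\<close>

lemma tensor_map_functional_action: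
  assumes l: "left_cointegral K H \<Delta> l" and one: "\<one>\<^bsub>H\<^esub> \<in> carrier H" and m: "m \<in> carrier M"
  shows "tensor_map K H M id (functional_action M \<rho> l) (\<rho> m) =
    pure_tensor K H M \<one>\<^bsub>H\<^esub> (functional_action M \<rho> l m)"
proof -
  let ?T = "functional_action M \<rho> l" and ?HM = "tensor K H M" and ?HH = "tensor K H H"
  let ?L = "tensor_lift (add_monoid M) (\<lambda>h n. l h \<odot>\<^bsub>M\<^esub> n)"
  \<comment> \<open>\<open>?\<Psi>\<close> applies \<lambda> to the middle factor of H \<otimes> (H
    \<otimes> M).\<close>
  let ?\<Psi> = "tensor_map K H M id ?L"
  have ld: "l \<in> dual K H" using l by (simp add: left_cointegral_def)
  note H = module_H and M = module_M and HM = module_HM and HH = tensor_module [OF module_H module_H]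
  note Lb = functional_smult_bilinear [OF ld M]
  note L = tensor_lift_linear [OF H M M Lb] and Lp = tensor_lift_pure [OF H M M Lb]
  have idM: "id \<in> module_hom K M M" and idH: "id \<in> module_hom K H H"
    by (simp_all add: module_hom_id id_def)
  note \<Psi> = tensor_map_linear [OF H HM H M idH L] and \<Psi>p = tensor_map_pure [OF H HM H M idH L]
  note a = tensor_assoc_linear [OF H H M] and ap = tensor_assoc_pure [OF H H M]
    and ab = tensor_assoc_bilinear [OF H H M]
  note D = tensor_map_linear [OF H M HH M H.comult_linear idM]
    and Dp = tensor_map_pure [OF H M HH M H.comult_linear idM]
  note R = tensor_map_linear [OF H M H HM idH coaction_linear]
    and Rp = tensor_map_pure [OF H M H HM idH coaction_linear]
  note T = functional_action_linear [OF ld]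
  note Q = tensor_map_linear [OF H M H M idH T] and Qp = tensor_map_pure [OF H M H M idH T]
  note X = coaction_in_tensor [OF m] and pb = pure_tensor_bilinear [OF H M]
  have "tensor_map K H M id ?T (\<rho> m) = ?\<Psi> (tensor_map K H ?HM id \<rho> (\<rho> m))"
  proof (rule tensor_hom_eqI [OF H M HM Q module_hom_compose [OF R \<Psi>] _ X])
    fix h n assume h: "h \<in> carrier H" and n: "n \<in> carrier M"
    show "tensor_map K H M id ?T (pure_tensor K H M h n) =
        ?\<Psi> (tensor_map K H ?HM id \<rho> (pure_tensor K H M h n))"
      using h n coaction_in_tensor [OF n]
      by (simp add: Qp Rp \<Psi>p functional_action_def del: carrier_tensor)
  qed
  also have "\<dots> = ?\<Psi> (tensor_assoc K H H M (tensor_map K ?HH M \<Delta> id (\<rho> m)))"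
    by (simp add: coaction_coassoc [OF m])
  also have "\<dots> = pure_tensor K H M \<one>\<^bsub>H\<^esub> (?L (\<rho> m))"
  proof (rule tensor_hom_eqI [where h = "\<lambda>X. ?\<Psi> (tensor_assoc K H H M (tensor_map K ?HH M \<Delta> id X))"
        and h' = "\<lambda>X. pure_tensor K H M \<one>\<^bsub>H\<^esub> (?L X)",
        OF H M HM module_hom_compose [OF module_hom_compose [OF D a] \<Psi>]
        module_hom_compose [OF L bilinear_map_right [OF pb one]] _ X])
    fix h n assume h: "h \<in> carrier H" and n: "n \<in> carrier M"
    note Dh = comult_in_tensor [OF h]
    have pn: "(\<lambda>y. pure_tensor K H M y n) \<in> module_hom K H ?HM"
      by (rule bilinear_map_left [OF pb n])
    have cb: "bilinear_map K H H H (\<lambda>x y. l y \<odot>\<^bsub>H\<^esub> x)"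
      by (rule bilinear_map_flip [OF functional_smult_bilinear [OF ld H]])
    have move: "pure_tensor K H M (a \<odot>\<^bsub>H\<^esub> x) n' = pure_tensor K H M x (a \<odot>\<^bsub>M\<^esub> n')"
      if "a \<in> carrier K" "x \<in> carrier H" "n' \<in> carrier M" for a x n'
      using pure_tensor_balanced [OF H M] that by (simp add: balanced_def)
    have "?\<Psi> (tensor_assoc K H H M (tensor_map K ?HH M \<Delta> id (pure_tensor K H M h n))) =
        ?\<Psi> (tensor_lift (add_monoid (tensor K H ?HM))
          (\<lambda>x y. pure_tensor K H ?HM x (pure_tensor K H M y n)) (\<Delta> h))"
      using h n Dh by (simp add: Dp ap del: carrier_tensor)
    also have "\<dots> = tensor_lift (add_monoid ?HM)
          (\<lambda>x y. ?\<Psi> (pure_tensor K H ?HM x (pure_tensor K H M y n))) (\<Delta> h)"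
      by (rule module_hom_tensor_lift [OF H H tensor_module [OF H HM] HM ab [OF n] \<Psi> Dh])
    also have "\<dots> = tensor_lift (add_monoid ?HM) (\<lambda>x y. pure_tensor K H M (l y \<odot>\<^bsub>H\<^esub> x) n) (\<Delta> h)"
      by (rule tensor_lift_cong [OF H H HM bilinear_map_postcompose [OF ab [OF n] \<Psi>]
          bilinear_map_postcompose [OF cb pn] _ Dh])
        (use n in \<open>simp add: \<Psi>p Lp move functional_in_carrier [OF ld] pure_tensor_closed del: carrier_tensor\<close>)
    also have "\<dots> = pure_tensor K H M (l h \<odot>\<^bsub>H\<^esub> \<one>\<^bsub>H\<^esub>) n"
      unfolding left_cointegral_contraction [OF l one h, symmetric]
      by (rule module_hom_tensor_lift [OF H H H HM cb pn Dh, symmetric])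
    also have "\<dots> = pure_tensor K H M \<one>\<^bsub>H\<^esub> (?L (pure_tensor K H M h n))"
      using h n one by (simp add: move functional_in_carrier [OF ld] Lp)
    finally show "?\<Psi> (tensor_assoc K H H M (tensor_map K ?HH M \<Delta> id (pure_tensor K H M h n))) =
        pure_tensor K H M \<one>\<^bsub>H\<^esub> (?L (pure_tensor K H M h n))" .
  qed
  finally show ?thesis by (simp add: functional_action_def)
qed

section \<open>The Rota-Baxter identity\<close>

lemma rota_baxter_functional_action:
  assumes cs: "cosemisimple_bialgebra K H \<Delta> \<epsilon> l"
  shows "rota_baxter_paired_comodule K H \<Delta> \<epsilon> M \<rho> (\<ominus>\<^bsub>K\<^esub> \<one>\<^bsub>K\<^esub>)
    (functional_action H \<Delta> l) (functional_action M \<rho> l)"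
proof -
  interpret B: cosemisimple_bialgebra K H \<Delta> \<epsilon> l by fact
  let ?T = "functional_action M \<rho> l" and ?P = "functional_action H \<Delta> l"
  let ?L = "tensor_lift (add_monoid M) (\<lambda>h n. l h \<odot>\<^bsub>M\<^esub> n)" and ?HM = "tensor K H M"
  have l: "left_cointegral K H \<Delta> l" by (rule B.cointegral)
  then have ld: "l \<in> dual K H" by (simp add: left_cointegral_def)
  have l1: "l \<one>\<^bsub>H\<^esub> = \<one>\<^bsub>K\<^esub>" using B.cointegral_normalized by (simp add: dual_counit_def)
  have one: "\<one>\<^bsub>H\<^esub> \<in> carrier H" by simp
  note H = module_H and M = module_M and HM = module_HM
  interpret HM: module K ?HM by (rule HM)
  note T = functional_action_linear [OF ld] and P = coalgebra_functional_action_linear [OF ld]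
  have idM: "id \<in> module_hom K M M" and idH: "id \<in> module_hom K H H"
    by (simp_all add: module_hom_id id_def)
  note Lb = functional_smult_bilinear [OF ld M] and Pb = functional_smult_bilinear [OF ld H]
  note L = tensor_lift_linear [OF H M M Lb] and Lp = tensor_lift_pure [OF H M M Lb]
  note Pi = tensor_map_linear [OF H M H M P idM] and Pip = tensor_map_pure [OF H M H M P idM]
  note iT = tensor_map_linear [OF H M H M idH T] and iTp = tensor_map_pure [OF H M H M idH T]
  note PT = tensor_map_linear [OF H M H M P T] and PTp = tensor_map_pure [OF H M H M P T]
  note Tc = module_hom_in_carrier [OF T] and Pc = module_hom_in_carrier [OF P]
  have P1: "?P \<one>\<^bsub>H\<^esub> = \<one>\<^bsub>H\<^esub>"
  proof -
    \<comment> \<open>The comultiplication is a ring homomorphism, and the unit of the tensor square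
      is 1 \<otimes> 1 by definition.\<close>
    have "\<Delta> \<one>\<^bsub>H\<^esub> = pure_tensor K H H \<one>\<^bsub>H\<^esub> \<one>\<^bsub>H\<^esub>"
      using ring_hom_one [OF B.comult_ring_hom] by (simp add: tensor_def)
    then show ?thesis
      using one by (simp add: functional_action_def tensor_lift_pure [OF H H H Pb] l1)
  qed
  \<comment> \<open>The cointegral identity with f = \<lambda>, where f(1) = 1.\<close>
  have lP: "l (?P h) = l h" if h: "h \<in> carrier H" for h
    using l ld h functional_in_carrier [OF ld h]
    by (simp add: functional_of_functional_action [OF ld h] left_cointegral_def dual_counit_def l1)
  have TT: "?T (?T m) = ?T m" if m: "m \<in> carrier M" for m
  proof -
    \<comment> \<open>The outer T contracts \<rho>(T m) = (P \<otimes> id) \<rho>(m), so \<lambda>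
      is applied after P and \<open>lP\<close> removes P.\<close>
    have "?T (?T m) = ?L (tensor_map K H M ?P id (\<rho> m))"
      by (simp add: functional_action_def [of M \<rho> l "?T m"] coaction_functional_action [OF ld P m])
    also have "\<dots> = ?L (\<rho> m)"
      by (rule tensor_hom_eqI [OF H M M module_hom_compose [OF Pi L] L _ coaction_in_tensor [OF m]])
        (simp add: Pip Lp Pc lP)
    finally show ?thesis by (simp add: functional_action_def)
  qed
  show ?thesis
  proof (unfold_locales)
    show "\<ominus>\<^bsub>K\<^esub> \<one>\<^bsub>K\<^esub> \<in> carrier K" by simp
    show "?P \<in> module_hom K H H" by (rule P)
    show "?T \<in> module_hom K M M" by (rule T)
    fix m assume m: "m \<in> carrier M"
    let ?u = "pure_tensor K H M \<one>\<^bsub>H\<^esub> (?T m)" and ?v = "\<rho> (?T m)"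
    have u: "?u \<in> carrier ?HM" by (rule pure_tensor_closed [OF one Tc [OF m]])
    have v: "?v \<in> carrier ?HM" by (rule coaction_in_tensor [OF Tc [OF m]])
    \<comment> \<open>Factoring P \<otimes> T with id \<otimes> T applied first turns \<rho>(m) into
      1 \<otimes> T m, on which P acts only on the unit.\<close>
    have "tensor_map K H M ?P ?T (\<rho> m) = tensor_map K H M ?P id (tensor_map K H M id ?T (\<rho> m))"
      by (rule tensor_hom_eqI [OF H M HM PT module_hom_compose [OF iT Pi] _ coaction_in_tensor [OF m]])
        (simp add: PTp iTp Pip Tc)
    then have "tensor_map K H M ?P ?T (\<rho> m) = ?u"
      by (simp add: tensor_map_functional_action [OF l one m] Pip one Tc [OF m] P1)
    \<comment> \<open>The first contraction is read backwards at T m: (P \<otimes> id) \<rho>(T m)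
      is \<rho>(T (T m)), and T is idempotent.\<close>
    moreover have "tensor_map K H M ?P id ?v = ?v"
      by (simp add: coaction_functional_action [OF ld P Tc [OF m], symmetric] TT [OF m])
    moreover have "tensor_map K H M id ?T ?v = ?u"
      by (simp add: tensor_map_functional_action [OF l one Tc [OF m]] TT [OF m])
    moreover have "?v \<oplus>\<^bsub>?HM\<^esub> ?u \<oplus>\<^bsub>?HM\<^esub> ((\<ominus>\<^bsub>K\<^esub> \<one>\<^bsub>K\<^esub>) \<odot>\<^bsub>?HM\<^esub> ?v) = ?u"
    proof -
      have "(\<ominus>\<^bsub>K\<^esub> \<one>\<^bsub>K\<^esub>) \<odot>\<^bsub>?HM\<^esub> ?v = \<ominus>\<^bsub>?HM\<^esub> ?v"
        using v by (simp add: HM.smult_l_minus del: carrier_tensor)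
      then show ?thesis
        using u v by (simp add: HM.M.a_comm [of ?v ?u] HM.M.a_assoc HM.M.r_neg del: carrier_tensor)
    qed
    ultimately show "tensor_map K H M ?P ?T (\<rho> m) =
        tensor_map K H M ?P id ?v \<oplus>\<^bsub>?HM\<^esub> tensor_map K H M id ?T ?v
          \<oplus>\<^bsub>?HM\<^esub> ((\<ominus>\<^bsub>K\<^esub> \<one>\<^bsub>K\<^esub>) \<odot>\<^bsub>?HM\<^esub> ?v)"
      by simp
  qed
qed

text \<open>T and P are known only on the carriers and may be arbitrary elsewhere. Tensors over the
  carriers do not see the difference, so the identity transfers from the canonical actions.\<close>

lemma rota_baxter_cointegral:
  assumes cs: "cosemisimple_bialgebra K H \<Delta> \<epsilon> l"
    and T: "\<And>m. m \<in> carrier M \<Longrightarrow> T m = functional_action M \<rho> l m"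
    and P: "\<And>h. h \<in> carrier H \<Longrightarrow> P h = functional_action H \<Delta> l h"
  shows "rota_baxter_paired_comodule K H \<Delta> \<epsilon> M \<rho> (\<ominus>\<^bsub>K\<^esub> \<one>\<^bsub>K\<^esub>) P T"
proof -
  interpret RB: rota_baxter_paired_comodule K H \<Delta> \<epsilon> M \<rho> "\<ominus>\<^bsub>K\<^esub> \<one>\<^bsub>K\<^esub>"
    "functional_action H \<Delta> l" "functional_action M \<rho> l"
    by (rule rota_baxter_functional_action [OF cs])
  note cong = tensor_map_cong [OF module_H module_M module_H module_M]
  have idM: "id \<in> module_hom K M M" and idH: "id \<in> module_hom K H H"
    by (simp_all add: module_hom_id id_def)
  show ?thesis
  proof unfold_locales
    show "P \<in> module_hom K H H" by (rule module_hom_cong [OF module_H RB.P_linear P])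
    show "T \<in> module_hom K M M" by (rule module_hom_cong [OF module_M RB.T_linear T])
    fix m assume m: "m \<in> carrier M"
    have "functional_action M \<rho> l m \<in> carrier M"
      by (rule module_hom_in_carrier [OF RB.T_linear m])
    note X = coaction_in_tensor [OF m] coaction_in_tensor [OF this]
    have "tensor_map K H M P T (\<rho> m) =
        tensor_map K H M (functional_action H \<Delta> l) (functional_action M \<rho> l) (\<rho> m)"
      by (rule cong [OF RB.P_linear RB.T_linear P T X(1)])
    moreover have "tensor_map K H M P id (\<rho> (T m)) =
        tensor_map K H M (functional_action H \<Delta> l) id (\<rho> (functional_action M \<rho> l m))"
      unfolding T [OF m] by (rule cong [OF RB.P_linear idM P refl X(2)])
    moreover have "tensor_map K H M id T (\<rho> (T m)) =
        tensor_map K H M id (functional_action M \<rho> l) (\<rho> (functional_action M \<rho> l m))"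
      unfolding T [OF m] by (rule cong [OF idH RB.T_linear refl T X(2)])
    ultimately show "tensor_map K H M P T (\<rho> m) =
        tensor_map K H M P id (\<rho> (T m)) \<oplus>\<^bsub>tensor K H M\<^esub> tensor_map K H M id T (\<rho> (T m))
          \<oplus>\<^bsub>tensor K H M\<^esub> ((\<ominus>\<^bsub>K\<^esub> \<one>\<^bsub>K\<^esub>) \<odot>\<^bsub>tensor K H M\<^esub> \<rho> (T m))"
      using RB.rota_baxter [OF m] by (simp add: T [OF m])
  qed (rule RB.weight)
qed

end

theorem corollary4p2:
  fixes K :: "('k, 'x) ring_scheme"
    and H :: "('k, 'h, 'y) module_scheme"
    and M :: "('k, 'm, 'z) module_scheme"
    and \<Delta> :: "'h \<Rightarrow> ('h \<times> 'h \<Rightarrow>\<^sub>0 int) set"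
    and \<epsilon> l :: "'h \<Rightarrow> 'k"
    and \<rho> :: "'m \<Rightarrow> ('h \<times> 'm \<Rightarrow>\<^sub>0 int) set"
    and P :: "'h \<Rightarrow> 'h"
    and T :: "'m \<Rightarrow> 'm"
  assumes "cosemisimple_bialgebra K H \<Delta> \<epsilon> l"
    and "left_comodule K H \<Delta> \<epsilon> M \<rho>"
    and "\<And>m. m \<in> carrier M \<Longrightarrow> T m = tensor_lift (add_monoid M) (\<lambda>h n. l h \<odot>\<^bsub>M\<^esub> n) (\<rho> m)"
    and "\<And>h. h \<in> carrier H \<Longrightarrow> P h = tensor_lift (add_monoid H) (\<lambda>x y. l x \<odot>\<^bsub>H\<^esub> y) (\<Delta> h)"
  shows "rota_baxter_paired_comodule K H \<Delta> \<epsilon> M \<rho> (\<ominus>\<^bsub>K\<^esub> \<one>\<^bsub>K\<^esub>) P T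
      \<and> rota_baxter_coalgebra K H \<Delta> \<epsilon> (\<ominus>\<^bsub>K\<^esub> \<one>\<^bsub>K\<^esub>) P"
proof -
  note cs = assms(1) and com = assms(2)
  interpret H: coalgebra K H \<Delta> \<epsilon>
    using com by (rule left_comodule.axioms(1))
  have T: "\<And>m. m \<in> carrier M \<Longrightarrow> T m = functional_action M \<rho> l m"
    and P: "\<And>h. h \<in> carrier H \<Longrightarrow> P h = functional_action H \<Delta> l h"
    using assms(3,4) by (simp_all add: functional_action_def)
  interpret S: rota_baxter_paired_comodule K H \<Delta> \<epsilon> H \<Delta> "\<ominus>\<^bsub>K\<^esub> \<one>\<^bsub>K\<^esub>" P P
    by (rule left_comodule.rota_baxter_cointegral [OF H.left_comodule_self cs P P])
  have "rota_baxter_coalgebra K H \<Delta> \<epsilon> (\<ominus>\<^bsub>K\<^esub> \<one>\<^bsub>K\<^esub>) P"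
    \<comment> \<open>For M = H with \<rho> = \<Delta> and T = P, the paired identity is literally
      the coalgebra identity.\<close>
    by unfold_locales (fact S.weight S.P_linear S.rota_baxter)+
  moreover have "rota_baxter_paired_comodule K H \<Delta> \<epsilon> M \<rho> (\<ominus>\<^bsub>K\<^esub> \<one>\<^bsub>K\<^esub>) P T"
    by (rule left_comodule.rota_baxter_cointegral [OF com cs T P])
  ultimately show ?thesis by blast
qed

end
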